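(* Let $n,m$ be positive integers, let $A\in\mathbb{R}^{n\times n}$, $B\in\mathbb{R}^{n\times m}$, let $\mu$ be the degree of the minimal polynomial of $A$, and let $\alpha>0$ be real with $k-1<\alpha\le k$, $k$ a positive integer. Let $t>0$ be finite. The Caputo fractional differential system of order $\alpha$ $$\left({}^{C}D_{0+}^{\alpha}x_\alpha\right)(\tau)=Ax_\alpha(\tau)+Bu(\tau)$$ is controllable in $[0,t]$ if and only if any one of the following three equivalent conditions holds: 1) $\operatorname{rank}\left[\,B\;\;AB\;\cdots\;A^{\mu-1}B\right]=n$; 2) $\operatorname{rank}\left[\lambda I_n-A\;\;B\right]=n$ for all $\lambda\in\sigma(A)$, where $\sigma(A)\subset\mathbb{C}$ is the spectrum of $A$; 3) $\displaystyle\int_0^{T}\Phi_\alpha(\tau)BB^T\Phi_\alpha^T(\tau)\,d\tau\succ0$ (positive definite) for any finite time interval $[0,T]$ of nonzero measure, where $\Phi_\alpha(\tau)=\sum_{\ell=0}^{\infty}\frac{A^\ell \tau^{\alpha\ell}}{\Gamma(\alpha(\ell+1))}$.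
   Context: The system is given initial conditions $x_\alpha^{(j)}(0)=x_{0j}\in\mathbb{R}^n$, $j=0,1,\dots,k-1$. Admissible controls $u$ are bounded piecewise continuous $\mathbb{R}^m$-valued functions. For each such $u$ and each set of initial conditions, the unique solution of the Caputo system is $$x_\alpha(t)=\sum_{j=0}^{k-1}t^{j}\Phi_{\alpha j}(t)x_{0j}+\int_0^t(t-\tau)^{\alpha-1}\Phi_\alpha(t-\tau)Bu(\tau)\,d\tau,$$ $$\Phi_{\alpha j}(t)=\sum_{\ell=0}^{\infty}\frac{A^\ell t^{\alpha\ell}}{\Gamma(\alpha\ell+j+1)},\qquad \Phi_\alpha(t)=\sum_{\ell=0}^{\infty}\frac{A^\ell t^{\alpha\ell}}{\Gamma(\alpha(\ell+1))},$$ where $\Gamma$ is the Gamma function. The system of order $\alpha$ is controllable in the time interval $[0,t]$ (of nonzero finite measure) if for any given initial conditions and any prescribed $x^*\in\mathbb{R}^n$ there exists an admissible control $u:[0,t]\to\mathbb{R}^m$ such that $x_\alpha(t)=x^*$. *)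

theory Defs
  imports "HOL-Analysis.Analysis" "HOL-Computational_Algebra.Polynomial"
begin

section \<open>Matrices\<close>

text \<open>On square matrices of type \<open>real^'n^'n\<close> the library's \<open>*\<close> and \<open>^\<close> act entrywise, so
  powers with respect to the matrix product \<open>**\<close> are introduced separately.\<close>

primrec matpow :: "real^'n^'n \<Rightarrow> nat \<Rightarrow> real^'n^'n" where
  "matpow A 0 = mat 1"
| "matpow A (Suc l) = A ** matpow A l"

definition poly_matrix :: "real poly \<Rightarrow> real^'n^'n \<Rightarrow> real^'n^'n" where
  "poly_matrix p A = (\<Sum>i\<le>degree p. coeff p i *\<^sub>R matpow A i)"

definition min_poly :: "real^'n^'n \<Rightarrow> real poly" where
  "min_poly A = (THE p. lead_coeff p = 1 \<and> poly_matrix p A = 0 \<and>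
     (\<forall>q. q \<noteq> 0 \<longrightarrow> poly_matrix q A = 0 \<longrightarrow> degree p \<le> degree q))"

text \<open>The rank of the block matrix \<open>[M 0, M 1, \<dots>, M (r - 1)]\<close>.  The number of its columns depends
  on the value \<open>r\<close> and so cannot be the cardinality of an index type; the set of its
  columns is the union of the column sets of the blocks, and its rank is the dimension of
  the space they span (compare \<open>column_rank_def\<close>).\<close>

definition block_row_rank :: "(nat \<Rightarrow> real^'m^'n) \<Rightarrow> nat \<Rightarrow> nat" where
  "block_row_rank M r = dim (\<Union>i<r. columns (M i))"

definition hcat :: "'a^'p^'n \<Rightarrow> 'a^'q^'n \<Rightarrow> 'a^('p + 'q)^'n" where
  "hcat M N = (\<chi> i j. case j of Inl c \<Rightarrow> M $ i $ c | Inr c \<Rightarrow> N $ i $ c)"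

abbreviation complex_matrix :: "real^'m^'n \<Rightarrow> complex^'m^'n" where
  "complex_matrix \<equiv> map_matrix complex_of_real"

definition spectrum :: "real^'n^'n \<Rightarrow> complex set" where
  "spectrum A = {z. \<not> invertible (mat z - complex_matrix A)}"

definition pos_definite :: "real^'n^'n \<Rightarrow> bool" where
  "pos_definite M \<longleftrightarrow> transpose M = M \<and> (\<forall>v. v \<noteq> 0 \<longrightarrow> 0 < v \<bullet> (M *v v))"

text \<open>The factor \<open>\<tau>\<^sup>\<alpha>\<^sup>l\<close> is written \<open>(\<tau> powr \<alpha>) ^ l\<close> because \<open>0 powr 0 = 0\<close>; with this form the
  term for \<open>l = 0\<close> is \<open>I / \<Gamma>(\<alpha>)\<close> also at \<open>\<tau> = 0\<close>.\<close>

definition Phi :: "real \<Rightarrow> real^'n^'n \<Rightarrow> real \<Rightarrow> real^'n^'n" where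
  "Phi \<alpha> A \<tau> = (\<Sum>l. ((\<tau> powr \<alpha>) ^ l / Gamma (\<alpha> * (real l + 1))) *\<^sub>R matpow A l)"


section \<open>The Caputo derivative\<close>

text \<open>Riemann-Liouville fractional integral of order \<open>\<beta> \<ge> 0\<close> with base point \<open>0\<close>; order \<open>0\<close> is
  the identity.\<close>

definition frac_integral :: "real \<Rightarrow> (real \<Rightarrow> 'a::euclidean_space) \<Rightarrow> real \<Rightarrow> 'a" where
  "frac_integral \<beta> f s =
     (if \<beta> = 0 then f s
      else (1 / Gamma \<beta>) *\<^sub>R integral {0..s} (\<lambda>\<tau>. ((s - \<tau>) powr (\<beta> - 1)) *\<^sub>R f \<tau>))"

text \<open>Iterated derivatives on an interval \<open>S\<close>, one-sided at its end points.\<close>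

primrec nderiv :: "real set \<Rightarrow> nat \<Rightarrow> (real \<Rightarrow> 'a::real_normed_vector) \<Rightarrow> real \<Rightarrow> 'a" where
  "nderiv S 0 f = f"
| "nderiv S (Suc j) f = (\<lambda>s. vector_derivative (nderiv S j f) (at s within S))"

definition times_differentiable_on ::
    "nat \<Rightarrow> (real \<Rightarrow> 'a::real_normed_vector) \<Rightarrow> real set \<Rightarrow> bool" where
  "times_differentiable_on r f S \<longleftrightarrow>
     (\<forall>j<r. \<forall>s\<in>S. nderiv S j f differentiable (at s within S))"

definition Ck_on :: "nat \<Rightarrow> (real \<Rightarrow> 'a::real_normed_vector) \<Rightarrow> real set \<Rightarrow> bool" where
  "Ck_on r f S \<longleftrightarrow> times_differentiable_on r f S \<and> continuous_on S (nderiv S r f)"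

text \<open>The Caputo derivative of order \<open>\<alpha>\<close>, \<open>k - 1 < \<alpha> \<le> k\<close>, of a function on \<open>[0,t]\<close> is the
  Riemann-Liouville derivative \<open>D\<^sup>k I\<^sup>k\<^sup>-\<^sup>\<alpha>\<close> of the function minus its Taylor polynomial of
  degree \<open>k - 1\<close> at \<open>0\<close>.  It agrees with \<open>I\<^sup>k\<^sup>-\<^sup>\<alpha> x\<^sup>(\<^sup>k\<^sup>)\<close> when \<open>x\<^sup>(\<^sup>k\<^sup>-\<^sup>1\<^sup>)\<close> is absolutely
  continuous.  The variation of constants formula has, for a merely piecewise continuous
  control, in general no \<open>k\<close>-th derivative, but it does have a Caputo derivative in this
  sense wherever the control is continuous.\<close>

definition has_caputo_derivative ::
    "real \<Rightarrow> nat \<Rightarrow> real \<Rightarrow> (real \<Rightarrow> 'a::euclidean_space) \<Rightarrow> 'a \<Rightarrow> real \<Rightarrow> bool" where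
  "has_caputo_derivative \<alpha> k t x d \<tau> \<longleftrightarrow>
     (let y = frac_integral (real k - \<alpha>)
                (\<lambda>s. x s - (\<Sum>j<k. (s ^ j / fact j) *\<^sub>R nderiv {0..t} j x 0))
      in times_differentiable_on (k - 1) y {0..t} \<and>
         (nderiv {0..t} (k - 1) y has_vector_derivative d) (at \<tau> within {0..t}))"


section \<open>The control system\<close>

definition piecewise_continuous_on :: "real \<Rightarrow> real \<Rightarrow> (real \<Rightarrow> 'a::topological_space) \<Rightarrow> bool" where
  "piecewise_continuous_on a b u \<longleftrightarrow>
     (\<exists>F. finite F \<and> F \<subseteq> {a..b} \<and> continuous_on ({a..b} - F) u \<and>
        (\<forall>s\<in>F. (\<exists>l. (u \<longlongrightarrow> l) (at s within {a..<s})) \<and>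
               (\<exists>l. (u \<longlongrightarrow> l) (at s within {s<..b}))))"

definition admissible_control :: "real \<Rightarrow> (real \<Rightarrow> real^'m) \<Rightarrow> bool" where
  "admissible_control t u \<longleftrightarrow> bounded (u ` {0..t}) \<and> piecewise_continuous_on 0 t u"

text \<open>At a jump of \<open>u\<close> the differential equation is not imposed: for an admissible control it
  is thus required at all but finitely many points of \<open>[0,t]\<close>.\<close>

definition caputo_solution ::
    "real \<Rightarrow> nat \<Rightarrow> real^'n^'n \<Rightarrow> real^'m^'n \<Rightarrow> real \<Rightarrow>
     (real \<Rightarrow> real^'m) \<Rightarrow> (nat \<Rightarrow> real^'n) \<Rightarrow> (real \<Rightarrow> real^'n) \<Rightarrow> bool" where
  "caputo_solution \<alpha> k A B t u x0 x \<longleftrightarrow>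
     Ck_on (k - 1) x {0..t} \<and>
     (\<forall>j<k. nderiv {0..t} j x 0 = x0 j) \<and>
     (\<forall>\<tau>\<in>{0..t}. continuous (at \<tau> within {0..t}) u \<longrightarrow>
        has_caputo_derivative \<alpha> k t x (A *v x \<tau> + B *v u \<tau>) \<tau>)"

definition caputo_controllable ::
    "real \<Rightarrow> nat \<Rightarrow> real^'n^'n \<Rightarrow> real^'m^'n \<Rightarrow> real \<Rightarrow> bool" where
  "caputo_controllable \<alpha> k A B t \<longleftrightarrow>
     (\<forall>(x0 :: nat \<Rightarrow> real^'n) (xstar :: real^'n).
        \<exists>u. admissible_control t u \<and>
            (\<exists>x. caputo_solution \<alpha> k A B t u x0 x \<and> x t = xstar))"

end

theory Submission
  imports Defs "HOL-Computational_Algebra.Fundamental_Theorem_Algebra"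
begin

text \<open>All four statements are equivalent to the nonexistence of a nonzero row vector \<open>v\<close> with
  \<open>v A\<^sup>l B = 0\<close> for every \<open>l\<close>, called \<open>kalman_condition\<close> below.

  Polynomial controls \<open>u(s) = s\<^sup>c e / c!\<close> yield explicit solutions: with zero initial data
  the state is \<open>\<Sum>\<^sub>l A\<^sup>l B e s\<^sup>\<alpha>\<^sup>+\<^sup>c\<^sup>+\<^sup>\<alpha>\<^sup>l / \<Gamma>(\<alpha> + c + \<alpha> l + 1)\<close>, because fractional integration
  and differentiation only shift the exponents of the normalised monomials \<open>s\<^sup>p / \<Gamma>(p + 1)\<close>.
  The reachable states at time \<open>t\<close> form a subspace, and letting \<open>c\<close> tend to infinity shows that a
  vector orthogonal to it annihilates every \<open>A\<^sup>l B\<close>.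

  Conversely, if \<open>v A\<^sup>l B = 0\<close> for all \<open>l\<close> and the initial data vanish, the functions
  \<open>Z\<^sub>l = I\<^sup>k (v A\<^sup>l x)\<close> satisfy \<open>Z\<^sub>l = I\<^sup>\<alpha> Z\<^sub>l\<^sub>+\<^sub>1\<close> whatever the control, and iterating this forces
  \<open>Z\<^sub>0 = 0\<close>, so \<open>v\<close> itself is never reached.  The semigroup law \<open>I\<^sup>a I\<^sup>b = I\<^sup>a\<^sup>+\<^sup>b\<close> needs no Fubini
  argument: it is clear on polynomials and extends by uniform approximation.\<close>

section \<open>Normalised monomials\<close>

text \<open>The obstacle is that \<open>caputo_solution\<close> admits every function satisfying the
  equation off the jumps of \<open>u\<close>, so an explicit formula is at hand only for states that
  are constructed. Sufficiency therefore uses polynomial controls instead of the usual Gramian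
  control: each state is a single Mittag-Leffler series and the equation holds on all of [0,t].
  Necessity takes an arbitrary solution and pairs it with v A^l before integrating, which removes B
  u; fractional integrals are then applied to continuous functions only, the class on which the
  semigroup law is proved. With z_l = v A^l x and \<beta> = k - \<alpha> the equation gives
  I^\<beta> z_l = I^k z_(l+1). The orders differ, so this is no recursion for z_l; applying
  I^\<alpha> makes it one for I^k z_l, and injectivity of I^k returns to z_0. The Gramian is
  compared with the Kalman condition directly, through a power series in \<tau>^\<alpha>.\<close>

lemma Gamma_plus1_real: "x > 0 \<Longrightarrow> Gamma (x + 1) = x * Gamma (x :: real)"
  by (rule Gamma_plus1) auto

lemma Gamma_real_nonzero [simp]: "x > (0::real) \<Longrightarrow> Gamma x \<noteq> 0"
  using Gamma_real_pos[of x] by linarith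

text \<open>Log-convexity of \<open>Gamma\<close> on [x + a, x + a + 1], evaluated at x + 1 = a (x +
  a) + (1 - a) (x + a + 1); this is Wendel's lower bound for \<open>Gamma (x + a)\<close>.\<close>

lemma Gamma_shift_ratio_le:
  fixes x a :: real
  assumes "x > 0" "0 < a" "a \<le> 1"
  shows "Gamma x / Gamma (x + a) \<le> (x + a) powr (1 - a) / x"
proof -
  have pos: "Gamma (x + a) > 0" "Gamma x > 0" "Gamma (x + 1) > 0" "Gamma (x+a+1) > 0"
    using assms by auto
  have "ln (Gamma ((1-(1-a)) *\<^sub>R (x + a) + (1-a) *\<^sub>R (x+a+1)))
      \<le> (1-(1-a)) * ln (Gamma (x + a)) + (1-a) * ln (Gamma (x+a+1))"
    using convex_onD[OF log_convex_Gamma_real, of "1-a" "x+a" "x+a+1"] assms by simp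
  also have "(1-(1-a)) *\<^sub>R (x + a) + (1-a) *\<^sub>R (x+a+1) = x + 1"
    by (simp add: algebra_simps)
  also have "ln (Gamma (x+a+1)) = ln (x + a) + ln (Gamma (x+a))"
    using assms pos Gamma_plus1_real[of "x+a"] by (simp add: ln_mult)
  finally have "ln (Gamma (x+1)) \<le> ln (Gamma (x+a)) + (1-a) * ln (x+a)"
    by (simp add: algebra_simps)
  also have "\<dots> = ln (Gamma (x+a) * (x+a) powr (1-a))"
    using assms pos by (simp add: ln_mult ln_powr)
  finally have "Gamma (x+1) \<le> Gamma (x+a) * (x+a) powr (1-a)"
    using assms pos by (subst (asm) ln_le_cancel_iff) auto
  moreover have "Gamma (x+1) = x * Gamma x"
    using assms by (intro Gamma_plus1_real) auto
  ultimately show ?thesis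
    using assms pos by (simp add: field_simps)
qed

text \<open>The previous bound covers shifts up to 1; a larger shift is reduced to
  \<open>b = min a 1\<close>, since \<open>Gamma\<close> is increasing beyond 2. This limit drives
  both the ratio test for the series and the later isolation of coefficients.\<close>

lemma Gamma_shift_ratio_tendsto_0:
  fixes a :: real
  assumes "a > 0"
  shows "((\<lambda>x. Gamma x / Gamma (x + a)) \<longlongrightarrow> 0) at_top"
proof -
  define b where "b = min a 1"
  have b: "0 < b" "b \<le> 1" "b \<le> a" using assms by (auto simp: b_def)
  show ?thesis
  proof (rule tendsto_sandwich)
    show "\<forall>\<^sub>F x in at_top. 0 \<le> Gamma x / Gamma (x + a)"
      using eventually_gt_at_top[of 0] by eventually_elim (use assms in auto)
    show "\<forall>\<^sub>F x in at_top. Gamma x / Gamma (x + a) \<le> (x + b) powr (1 - b) / x"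
      using eventually_gt_at_top[of 2]
    proof eventually_elim
      case (elim x)
      have "Gamma (x + b) \<le> Gamma (x + a)"
        using Gamma_real_strict_mono[of "x+b" "x+a"] b elim
        by (cases "b = a") auto
      then have "Gamma x / Gamma (x + a) \<le> Gamma x / Gamma (x + b)"
        using elim b assms by (intro divide_left_mono) auto
      also have "\<dots> \<le> (x + b) powr (1 - b) / x"
        using Gamma_shift_ratio_le b elim by auto
      finally show ?case .
    qed
    show "((\<lambda>x. (x + b) powr (1 - b) / x) \<longlongrightarrow> 0) at_top"
      using b by real_asymp
  qed auto
qed

text \<open>The normalisation lets integration of order \<beta> send exponent p to p + \<beta> with
  no factor. Exponent 0 is a separate case because \<open>0 powr 0 = 0\<close>, which would break
  continuity of the constant 1 at the end point 0.\<close>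

definition frac_monom :: "real \<Rightarrow> real \<Rightarrow> real" where
  "frac_monom p s = (if p = 0 then 1 else s powr p / Gamma (p + 1))"

lemma frac_monom_nonneg: "p \<ge> 0 \<Longrightarrow> frac_monom p s \<ge> 0"
  by (auto simp: frac_monom_def intro!: divide_nonneg_nonneg less_imp_le[OF Gamma_real_pos])

lemma frac_monom_eq: "s > 0 \<Longrightarrow> frac_monom p s = s powr p / Gamma (p + 1)"
  by (auto simp: frac_monom_def)

lemma frac_monom_at_0: "p > 0 \<Longrightarrow> frac_monom p 0 = 0"
  by (auto simp: frac_monom_def)

lemma frac_monom_mono: "p \<ge> 0 \<Longrightarrow> 0 \<le> s \<Longrightarrow> s \<le> t \<Longrightarrow> frac_monom p s \<le> frac_monom p t"
  by (auto simp: frac_monom_def intro!: divide_right_mono powr_mono2 less_imp_le[OF Gamma_real_pos])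

lemma frac_monom_nat: "s \<ge> 0 \<Longrightarrow> frac_monom (real j) s = s ^ j / fact j"
  by (cases "s = 0") (auto simp: frac_monom_def powr_realpow Gamma_fact[symmetric] add.commute)

lemma continuous_on_frac_monom: "p \<ge> 0 \<Longrightarrow> continuous_on {0..t} (frac_monom p)"
  unfolding frac_monom_def
  by (cases "p = 0") (auto intro!: continuous_on_divide continuous_on_powr')

text \<open>The rule for \<open>powr\<close> needs a positive base, so the end point 0 is handled
  separately: for p = 1 the function is the identity on the interval, and for p > 1 the difference
  quotient is s^(p - 1) / Gamma(p + 1), which tends to 0.\<close>

lemma frac_monom_has_derivative:
  assumes "p \<ge> 1" "s \<in> {0..t}"
  shows "(frac_monom p has_vector_derivative frac_monom (p - 1) s) (at s within {0..t})"
proof (cases "s = 0")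
  case False
  then have s: "s > 0" using assms by auto
  have "((\<lambda>s. s powr p / Gamma (p + 1)) has_real_derivative (p * s powr (p - 1)) / Gamma (p + 1)) (at s)"
    using s assms by (auto intro!: derivative_eq_intros)
  also have "p * s powr (p - 1) / Gamma (p + 1) = frac_monom (p - 1) s"
    using assms s Gamma_plus1_real[of p] by (simp add: frac_monom_eq)
  also have "(\<lambda>s. s powr p / Gamma (p + 1)) = frac_monom p"
    using assms by (auto simp: frac_monom_def)
  finally show ?thesis
    by (simp add: has_real_derivative_iff_has_vector_derivative has_vector_derivative_at_within)
next
  case True
  show ?thesis
  proof (cases "p = 1")
    case p: True
    have "(id has_vector_derivative 1) (at s within {0..t})"
      unfolding id_def by (auto intro!: derivative_eq_intros)
    moreover have "frac_monom p y = id y" if "y \<in> {0..t}" for y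
      using that p frac_monom_nat[of y 1] by simp
    ultimately have "(frac_monom p has_vector_derivative 1) (at s within {0..t})"
      using assms(2) has_vector_derivative_transform by blast
    then show ?thesis
      using p by (simp add: frac_monom_def)
  next
    case False
    then have p: "p > 1" using assms by auto
    have "((\<lambda>s. s powr (p - 1) / Gamma (p + 1)) \<longlongrightarrow> 0 powr (p - 1) / Gamma (p + 1)) (at 0 within {0..t})"
      using p
      by (intro tendsto_intros tendsto_powr') (auto simp: eventually_at_filter)
    then have "((\<lambda>s. s powr (p - 1) / Gamma (p + 1)) \<longlongrightarrow> 0) (at 0 within {0..t})"
      using p by simp
    then have "((\<lambda>y. (frac_monom p y - frac_monom p 0) / (y - 0)) \<longlongrightarrow> 0) (at 0 within {0..t})"
    proof (rule Lim_transform_eventually[where f="\<lambda>s. s powr (p - 1) / Gamma (p + 1)"])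
      show "\<forall>\<^sub>F y in at 0 within {0..t}.
          y powr (p - 1) / Gamma (p + 1) = (frac_monom p y - frac_monom p 0) / (y - 0)"
        using p by (auto simp: eventually_at_filter frac_monom_def powr_diff)
    qed
    then have "(frac_monom p has_real_derivative 0) (at 0 within {0..t})"
      by (simp add: has_field_derivative_iff)
    then show ?thesis
      using True p by (simp add: frac_monom_at_0 has_real_derivative_iff_has_vector_derivative)
  qed
qed

section \<open>The fractional integral\<close>

text \<open>Euler's Beta integral on [0,1], stretched to [0,s]; B(p + 1, \<beta>) = Gamma(p + 1)
  Gamma(\<beta>) / Gamma(p + 1 + \<beta>) supplies exactly the normalisation of the new
  monomial.\<close>

lemma has_integral_frac_kernel_monom:
  assumes "\<beta> > 0" "p \<ge> 0" "s \<ge> 0"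
  shows "((\<lambda>\<tau>. (s - \<tau>) powr (\<beta> - 1) * frac_monom p \<tau>) has_integral Gamma \<beta> * frac_monom (p + \<beta>) s) {0..s}"
proof (cases "s = 0")
  case True
  then show ?thesis
    using assms by (auto simp: frac_monom_at_0)
next
  case False
  then have s: "s > 0" using assms by auto
  have img: "(\<lambda>x. x / (1 / s)) ` {0..1} = {0..s}"
  proof safe
    fix x assume "x \<in> {0..s}"
    then show "x \<in> (\<lambda>x. x / (1 / s)) ` {0..1}"
      using s by (intro image_eqI[of _ _ "x / s"]) (auto simp: field_simps)
  qed (use s in \<open>auto simp: field_simps mult_left_le\<close>)
  have "((\<lambda>x. ((1 / s) * x) powr ((p + 1) - 1) * (1 - (1 / s) * x) powr (\<beta> - 1)) has_integral
      (1 / \<bar>1 / s\<bar>) *\<^sub>R Beta (p + 1) \<beta>) ((\<lambda>x. x / (1 / s)) ` {0..1})"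
    using assms s by (intro has_integral_stretch_real has_integral_Beta_real) auto
  then have "((\<lambda>x. (x / s) powr p * (1 - x / s) powr (\<beta> - 1)) has_integral s * Beta (p + 1) \<beta>) {0..s}"
    using s unfolding img by simp
  then have *: "((\<lambda>x. (s powr (p + \<beta> - 1) / Gamma (p + 1)) * ((x / s) powr p * (1 - x / s) powr (\<beta> - 1))) has_integral
      (s powr (p + \<beta> - 1) / Gamma (p + 1)) * (s * Beta (p + 1) \<beta>)) {0..s}"
    by (rule has_integral_mult_right)
  have val: "(s powr (p + \<beta> - 1) / Gamma (p + 1)) * (s * Beta (p + 1) \<beta>) = Gamma \<beta> * frac_monom (p + \<beta>) s"
    using s assms by (simp add: frac_monom_eq Beta_def powr_diff ac_simps)
  show ?thesis
    using * unfolding val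
  \<comment> \<open>Positive bases are needed to split the powers; at 0 with p = 0 the integrands
    really differ, since \<open>frac_monom 0 0 = 1\<close> while
    \<open>(0 / s) powr 0 = 0\<close>.\<close>
  proof (rule has_integral_spike_finite[where S="{0,s}", rotated 2])
    fix x assume "x \<in> {0..s} - {0, s}"
    then have x: "0 < x" "x < s" by auto
    have "(x / s) powr p = x powr p / s powr p" using x s by (simp add: powr_divide)
    moreover have "1 - x / s = (s - x) / s" using s by (simp add: field_simps)
    then have "(1 - x / s) powr (\<beta> - 1) = (s - x) powr (\<beta> - 1) / s powr (\<beta> - 1)"
      using x s by (simp add: powr_divide)
    moreover have "s powr (p + \<beta> - 1) = s powr p * s powr (\<beta> - 1)"
      using powr_add[of s p "\<beta> - 1"] by (simp add: algebra_simps)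
    ultimately show "(s - x) powr (\<beta> - 1) * frac_monom p x =
        (s powr (p + \<beta> - 1) / Gamma (p + 1)) * ((x / s) powr p * (1 - x / s) powr (\<beta> - 1))"
      using x s by (simp add: frac_monom_eq)
  qed auto
qed

text \<open>For \<beta> < 1 the kernel is unbounded near s. It is nonnegative with a finite
  integral, the case p = 0 of the Beta integral, hence absolutely integrable, and the continuous
  factor is bounded and measurable.\<close>

lemma frac_kernel_integrable:
  fixes f :: "real \<Rightarrow> 'a::euclidean_space"
  assumes "\<beta> > 0" "continuous_on {0..s} f"
  shows "(\<lambda>\<tau>. (s - \<tau>) powr (\<beta> - 1) *\<^sub>R f \<tau>) absolutely_integrable_on {0..s}"
proof (cases "s \<ge> 0")
  case True
  have "(\<lambda>\<tau>. (s - \<tau>) powr (\<beta> - 1)) integrable_on {0..s}"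
    using has_integral_frac_kernel_monom[OF assms(1), of 0 s] True
    by (auto simp: frac_monom_def)
  then have k: "(\<lambda>\<tau>. (s - \<tau>) powr (\<beta> - 1)) absolutely_integrable_on {0..s}"
    by (intro nonnegative_absolutely_integrable_1) auto
  show ?thesis
  proof (rule absolutely_integrable_bounded_measurable_product[where h="\<lambda>x c. c *\<^sub>R x"])
    show "bilinear (\<lambda>(x::'a) c. c *\<^sub>R x)"
      by (auto simp: bilinear_def algebra_simps intro!: linearI)
    show "f \<in> borel_measurable (lebesgue_on {0..s})"
      using assms by (intro continuous_imp_measurable_on_sets_lebesgue) auto
    show "bounded (f ` {0..s})"
      using assms by (intro compact_imp_bounded compact_continuous_image) auto
  qed (use k in auto)
qed auto

lemma frac_kernel_integrable':
  fixes f :: "real \<Rightarrow> 'a::euclidean_space"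
  assumes "\<beta> > 0" "continuous_on {0..t} f" "s \<in> {0..t}"
  shows "(\<lambda>\<tau>. (s - \<tau>) powr (\<beta> - 1) *\<^sub>R f \<tau>) integrable_on {0..s}"
  using assms by (intro set_lebesgue_integral_eq_integral(1) frac_kernel_integrable) (auto elim!: continuous_on_subset)

section \<open>Linearity, bounds and limits of the fractional integral\<close>

lemma frac_integral_cong:
  assumes "\<And>\<tau>. \<tau> \<in> {0..s} \<Longrightarrow> f \<tau> = g \<tau>" "s \<ge> 0"
  shows "frac_integral \<beta> f s = frac_integral \<beta> g s"
  unfolding frac_integral_def using assms by (auto intro!: arg_cong[of _ _ "(*\<^sub>R) _"] integral_cong)

lemma frac_integral_add:
  assumes "continuous_on {0..t} f" "continuous_on {0..t} g" "s \<in> {0..t}" "\<beta> \<ge> 0"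
  shows "frac_integral \<beta> (\<lambda>\<tau>. f \<tau> + g \<tau>) s = frac_integral \<beta> f s + frac_integral \<beta> g s"
  unfolding frac_integral_def using assms
  by (auto simp: scaleR_add_right frac_kernel_integrable'[of _ t] integral_add)

lemma frac_integral_scaleR:
  "frac_integral \<beta> (\<lambda>\<tau>. c *\<^sub>R f \<tau>) s = c *\<^sub>R frac_integral \<beta> f s"
  unfolding frac_integral_def by (simp add: scaleR_left_commute[of _ c] del: scaleR_scaleR)

lemma frac_integral_diff:
  assumes "continuous_on {0..t} f" "continuous_on {0..t} g" "s \<in> {0..t}" "\<beta> \<ge> 0"
  shows "frac_integral \<beta> (\<lambda>\<tau>. f \<tau> - g \<tau>) s = frac_integral \<beta> f s - frac_integral \<beta> g s"
  unfolding frac_integral_def using assms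
  by (auto simp: scaleR_diff_right frac_kernel_integrable'[of _ t] integral_diff)

lemma frac_integral_sum:
  assumes "\<And>i. i \<in> I \<Longrightarrow> continuous_on {0..t} (f i)" "s \<in> {0..t}" "\<beta> \<ge> 0"
  shows "frac_integral \<beta> (\<lambda>\<tau>. \<Sum>i\<in>I. f i \<tau>) s = (\<Sum>i\<in>I. frac_integral \<beta> (f i) s)"
  using assms(1)
proof (induction I rule: infinite_finite_induct)
  case (insert i I)
  then show ?case
    using assms by (simp add: frac_integral_add[where t=t] continuous_on_sum)
qed (auto simp: frac_integral_def)

lemma frac_integral_inner:
  assumes "continuous_on {0..t} f" "s \<in> {0..t}" "\<beta> \<ge> 0"
  shows "frac_integral \<beta> f s \<bullet> w = frac_integral \<beta> (\<lambda>\<tau>. f \<tau> \<bullet> w) s"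
proof (cases "\<beta> = 0")
  case False
  with assms have "(\<lambda>\<tau>. (s - \<tau>) powr (\<beta> - 1) *\<^sub>R f \<tau>) integrable_on {0..s}"
    by (intro frac_kernel_integrable'[of _ t]) auto
  from integral_linear[OF this bounded_linear_inner_left[of w]]
  show ?thesis
    using False by (simp add: frac_integral_def o_def)
qed (auto simp: frac_integral_def)

lemma frac_integral_frac_monom:
  assumes "p \<ge> 0" "\<beta> \<ge> 0" "s \<ge> 0"
  shows "frac_integral \<beta> (\<lambda>\<tau>. frac_monom p \<tau> *\<^sub>R w) s = frac_monom (p + \<beta>) s *\<^sub>R w"
proof (cases "\<beta> = 0")
  case False
  with assms have "((\<lambda>\<tau>. ((s - \<tau>) powr (\<beta> - 1) * frac_monom p \<tau>) *\<^sub>R w) has_integral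
      (Gamma \<beta> * frac_monom (p + \<beta>) s) *\<^sub>R w) {0..s}"
    by (intro has_integral_scaleR_left has_integral_frac_kernel_monom) auto
  then show ?thesis
    using False assms by (simp add: frac_integral_def integral_unique)
qed (auto simp: frac_integral_def)

lemma frac_integral_norm_bound:
  assumes "continuous_on {0..t} f" "continuous_on {0..t} g" "s \<in> {0..t}" "\<beta> \<ge> 0"
    and "\<And>\<tau>. \<tau> \<in> {0..s} \<Longrightarrow> norm (f \<tau>) \<le> g \<tau>"
  shows "norm (frac_integral \<beta> f s) \<le> frac_integral \<beta> g s"
proof (cases "\<beta> = 0")
  case False
  then have "norm (integral {0..s} (\<lambda>\<tau>. (s - \<tau>) powr (\<beta> - 1) *\<^sub>R f \<tau>)) \<le> integral {0..s} (\<lambda>\<tau>. (s - \<tau>) powr (\<beta> - 1) *\<^sub>R g \<tau>)"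
    using assms by (intro integral_norm_bound_integral frac_kernel_integrable'[of _ t]) (auto intro!: mult_left_mono)
  then show ?thesis
    using False assms by (auto simp: frac_integral_def divide_right_mono)
qed (use assms in \<open>auto simp: frac_integral_def\<close>)

lemma frac_integral_norm_bound_const:
  assumes "continuous_on {0..t} f" "s \<in> {0..t}" "\<beta> \<ge> 0" "\<And>\<tau>. \<tau> \<in> {0..s} \<Longrightarrow> norm (f \<tau>) \<le> c"
  shows "norm (frac_integral \<beta> f s) \<le> c * frac_monom \<beta> t"
proof -
  have "norm (frac_integral \<beta> f s) \<le> frac_integral \<beta> (\<lambda>\<tau>. frac_monom 0 \<tau> *\<^sub>R c) s"
    using assms by (intro frac_integral_norm_bound[of t]) (auto simp: frac_monom_def)
  also have "\<dots> = frac_monom \<beta> s *\<^sub>R c"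
    using assms frac_integral_frac_monom[of 0 \<beta> s c] by simp
  also have "\<dots> \<le> frac_monom \<beta> t *\<^sub>R c"
    using assms(2,3) order_trans[OF norm_ge_zero assms(4)[of 0]]
    by (auto intro!: mult_right_mono frac_monom_mono)
  finally show ?thesis by (simp add: mult.commute)
qed

text \<open>Uniform convergence survives because the operator has sup-norm bound
  \<open>frac_monom \<beta> t\<close> on [0,t].\<close>

lemma uniform_limit_frac_integral:
  assumes "uniform_limit {0..t} f g F" "\<And>n. continuous_on {0..t} (f n)" "continuous_on {0..t} g" "\<beta> \<ge> 0"
  shows "uniform_limit {0..t} (\<lambda>n. frac_integral \<beta> (f n)) (frac_integral \<beta> g) F"
proof (rule uniform_limitI)
  fix e :: real assume "e > 0"
  \<comment> \<open>The added 1 keeps the divisor positive when \<open>frac_monom \<beta> t\<close>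
    is 0 and makes the final estimate strict.\<close>
  define C where "C = frac_monom \<beta> t + 1"
  have C: "C > 0" "frac_monom \<beta> t < C"
    using frac_monom_nonneg[OF assms(4), of t] by (auto simp: C_def)
  have "\<forall>\<^sub>F n in F. \<forall>x\<in>{0..t}. dist (f n x) (g x) < e / C"
    using assms(1) \<open>e > 0\<close> C by (intro uniform_limitD) auto
  then show "\<forall>\<^sub>F n in F. \<forall>x\<in>{0..t}. dist (frac_integral \<beta> (f n) x) (frac_integral \<beta> g x) < e"
  proof eventually_elim
    case (elim n)
    show ?case
    proof
      fix s assume s: "s \<in> {0..t}"
      have "norm (frac_integral \<beta> (\<lambda>\<tau>. f n \<tau> - g \<tau>) s) \<le> e / C * frac_monom \<beta> t"
        using assms elim s by (intro frac_integral_norm_bound_const continuous_intros)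
          (auto simp: dist_norm intro!: less_imp_le)
      also have "\<dots> < e / C * C"
        using C \<open>e > 0\<close> by (intro mult_strict_left_mono) auto
      finally show "dist (frac_integral \<beta> (f n) s) (frac_integral \<beta> g s) < e"
        using C assms s by (simp add: dist_norm frac_integral_diff[of t])
    qed
  qed
qed

text \<open>Stone-Weierstrass, with \<tau>^i rewritten as i! times
  \<open>frac_monom i \<tau>\<close>, so that fractional integration merely shifts each
  exponent.\<close>

lemma continuous_uniform_limit_frac_monoms:
  fixes f :: "real \<Rightarrow> real"
  assumes "continuous_on {0..t} f"
  obtains a :: "nat \<Rightarrow> nat \<Rightarrow> real" and N :: "nat \<Rightarrow> nat"
  where "uniform_limit {0..t} (\<lambda>n \<tau>. \<Sum>i\<le>N n. frac_monom (real i) \<tau> *\<^sub>R a n i) f sequentially"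
proof -
  have "\<exists>a N. \<forall>\<tau>\<in>{0..t}. \<bar>f \<tau> - (\<Sum>i\<le>N. frac_monom (real i) \<tau> *\<^sub>R a i)\<bar> < inverse (real (Suc n))" for n
  proof -
    obtain g where g: "real_polynomial_function g" "\<And>x. x \<in> {0..t} \<Longrightarrow> \<bar>f x - g x\<bar> < inverse (real (Suc n))"
      using Stone_Weierstrass_real_polynomial_function[of "{0..t}" f "inverse (real (Suc n))"] assms by auto
    then obtain a N where "g = (\<lambda>x. \<Sum>i\<le>N. a i * x ^ i)"
      using real_polynomial_function_iff_sum by auto
    then have "g \<tau> = (\<Sum>i\<le>N. frac_monom (real i) \<tau> *\<^sub>R (fact i * a i))" if "\<tau> \<in> {0..t}" for \<tau>
      using that by (auto simp: frac_monom_nat intro!: sum.cong)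
    with g show ?thesis
      by (intro exI[of _ "\<lambda>i. fact i * a i"] exI[of _ N]) auto
  qed
  then obtain a N where an: "\<And>n \<tau>. \<tau> \<in> {0..t} \<Longrightarrow>
      \<bar>f \<tau> - (\<Sum>i\<le>N n. frac_monom (real i) \<tau> *\<^sub>R a n i)\<bar> < inverse (real (Suc n))"
    by metis
  have "uniform_limit {0..t} (\<lambda>n \<tau>. \<Sum>i\<le>N n. frac_monom (real i) \<tau> *\<^sub>R a n i) f sequentially"
  proof (rule uniform_limitI)
    fix e :: real assume "e > 0"
    then have "\<forall>\<^sub>F n in sequentially. inverse (real (Suc n)) < e"
      using LIMSEQ_inverse_real_of_nat order_tendstoD(2) by blast
    then show "\<forall>\<^sub>F n in sequentially. \<forall>x\<in>{0..t}. dist (\<Sum>i\<le>N n. frac_monom (real i) x *\<^sub>R a n i) (f x) < e"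
      by eventually_elim (use an in \<open>fastforce simp: dist_real_def abs_minus_commute intro: less_trans\<close>)
  qed
  then show ?thesis by (rule that)
qed

lemma continuous_on_frac_monom_sum:
  "continuous_on {0..t} (\<lambda>\<tau>. \<Sum>i\<le>N. frac_monom (real i + b) \<tau> *\<^sub>R (a i :: real))" if "b \<ge> 0"
  using that by (intro continuous_on_sum continuous_on_scaleR continuous_on_frac_monom continuous_on_const) auto

lemma frac_integral_frac_monom_sum:
  assumes "s \<in> {0..t}" "b \<ge> 0" "\<beta> \<ge> 0"
  shows "frac_integral \<beta> (\<lambda>\<tau>. \<Sum>i\<le>N. frac_monom (real i + b) \<tau> *\<^sub>R (a i :: real)) s
     = (\<Sum>i\<le>N. frac_monom (real i + (b + \<beta>)) s *\<^sub>R a i)"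
  using assms
  by (subst frac_integral_sum[where t=t])
     (auto simp: frac_integral_frac_monom[where 'a=real, simplified] add.assoc intro!: continuous_intros continuous_on_frac_monom)

text \<open>Continuity and the semigroup law are proved together: passing to the limit under the
  outer integral requires \<open>frac_integral b f\<close> to be continuous, and this follows from
  the same approximants, whose integrals converge uniformly.\<close>

lemma continuous_frac_integral_and_semigroup_real:
  fixes f :: "real \<Rightarrow> real"
  assumes "continuous_on {0..t} f" "a \<ge> 0" "b \<ge> 0"
  shows "continuous_on {0..t} (frac_integral a f)"
    and "s \<in> {0..t} \<Longrightarrow> frac_integral a (frac_integral b f) s = frac_integral (a + b) f s"
proof -
  obtain A N where lim: "uniform_limit {0..t} (\<lambda>n \<tau>. \<Sum>i\<le>N n. frac_monom (real i) \<tau> *\<^sub>R A n i) f sequentially"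
    using continuous_uniform_limit_frac_monoms[OF assms(1)] by blast
  \<comment> \<open>On [0,t], \<open>P b n\<close> is the integral of order b of the n-th
    approximating polynomial, so both sides of the law become limits of
    \<open>P (a + b) n\<close>.\<close>
  define P where "P = (\<lambda>b n \<tau>. \<Sum>i\<le>N n. frac_monom (real i + b) \<tau> *\<^sub>R A n i)"
  have contP: "continuous_on {0..t} (P b n)" if "b \<ge> 0" for b n
    unfolding P_def using that by (rule continuous_on_frac_monom_sum)
  have FIP: "frac_integral a (P b n) s = P (b + a) n s" if "b \<ge> 0" "a \<ge> 0" "s \<in> {0..t}" for a b n s
    unfolding P_def using that by (intro frac_integral_frac_monom_sum) auto
  have lim0: "uniform_limit {0..t} (P 0) f sequentially"
    using lim by (simp add: P_def)
  have lim1: "uniform_limit {0..t} (P b) (frac_integral b f) sequentially" if "b \<ge> 0" for b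
  proof (rule uniform_limit_cong'[THEN iffD1])
    show "uniform_limit {0..t} (\<lambda>n. frac_integral b (P 0 n)) (frac_integral b f) sequentially"
      using lim0 contP assms that by (intro uniform_limit_frac_integral) auto
  qed (use FIP that in auto)
  have cont: "continuous_on {0..t} (frac_integral b f)" if "b \<ge> 0" for b
    using lim1[OF that] contP[OF that] by (intro uniform_limit_theorem[where F=sequentially]) auto
  then show "continuous_on {0..t} (frac_integral a f)" using assms by auto
  assume s: "s \<in> {0..t}"
  have "uniform_limit {0..t} (\<lambda>n. frac_integral a (P b n)) (frac_integral a (frac_integral b f)) sequentially"
    using lim1 contP cont assms by (intro uniform_limit_frac_integral) auto
  then have "(\<lambda>n. frac_integral a (P b n) s) \<longlonglongrightarrow> frac_integral a (frac_integral b f) s"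
    using s by (rule tendsto_uniform_limitI)
  then have "(\<lambda>n. P (a + b) n s) \<longlonglongrightarrow> frac_integral a (frac_integral b f) s"
    using FIP assms s by (simp add: add.commute)
  moreover have "(\<lambda>n. P (a + b) n s) \<longlonglongrightarrow> frac_integral (a + b) f s"
    using lim1[of "a + b"] s assms by (intro tendsto_uniform_limitI) auto
  ultimately show "frac_integral a (frac_integral b f) s = frac_integral (a + b) f s"
    by (rule LIMSEQ_unique)
qed

lemma continuous_on_frac_integral:
  fixes f :: "real \<Rightarrow> 'a::euclidean_space"
  assumes "continuous_on {0..t} f" "\<beta> \<ge> 0"
  shows "continuous_on {0..t} (frac_integral \<beta> f)"
proof (subst continuous_on_componentwise, rule ballI)
  fix i :: 'a
  have "continuous_on {0..t} (frac_integral \<beta> (\<lambda>\<tau>. f \<tau> \<bullet> i))"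
    using assms by (intro continuous_frac_integral_and_semigroup_real(1)[where b=0] continuous_intros) auto
  then show "continuous_on {0..t} (\<lambda>x. frac_integral \<beta> f x \<bullet> i)"
    by (rule continuous_on_eq) (use assms in \<open>simp add: frac_integral_inner\<close>)
qed

lemma frac_integral_frac_integral:
  fixes f :: "real \<Rightarrow> 'a::euclidean_space"
  assumes "continuous_on {0..t} f" "a \<ge> 0" "b \<ge> 0" "s \<in> {0..t}"
  shows "frac_integral a (frac_integral b f) s = frac_integral (a + b) f s"
proof (rule euclidean_eqI)
  fix i :: 'a
  have "frac_integral a (frac_integral b f) s \<bullet> i = frac_integral a (\<lambda>\<tau>. frac_integral b f \<tau> \<bullet> i) s"
    using assms by (intro frac_integral_inner[of t] continuous_on_frac_integral) auto
  also have "\<dots> = frac_integral a (frac_integral b (\<lambda>\<tau>. f \<tau> \<bullet> i)) s"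
    using assms by (intro frac_integral_cong frac_integral_inner[of t]) auto
  also have "\<dots> = frac_integral (a + b) (\<lambda>\<tau>. f \<tau> \<bullet> i) s"
    using assms by (intro continuous_frac_integral_and_semigroup_real(2)[of t] continuous_intros) auto
  also have "\<dots> = frac_integral (a + b) f s \<bullet> i"
    using assms by (intro frac_integral_inner[of t, symmetric]) auto
  finally show "frac_integral a (frac_integral b f) s \<bullet> i = frac_integral (a + b) f s \<bullet> i" .
qed

lemma frac_integral_1:
  assumes "s \<ge> 0"
  shows "frac_integral 1 f s = integral {0..s} f"
proof -
  \<comment> \<open>At \<tau> = s the kernel is \<open>0 powr 0 = 0\<close> instead of 1, so the
    integrands are compared off that point.\<close>
  have "integral {0..s} (\<lambda>\<tau>. (s - \<tau>) powr (1 - 1) *\<^sub>R f \<tau>) = integral {0..s} f"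
    by (rule integral_spike[where S="{s}"]) auto
  then show ?thesis by (simp add: frac_integral_def)
qed

section \<open>Matrix Mittag-Leffler functions\<close>

lemma norm_matrix_vector_mult_le:
  fixes A :: "real^'n^'m"
  obtains M where "M > 0" "\<And>v. norm (A *v v) \<le> M * norm v"
  using bounded_linear.pos_bounded[OF matrix_vector_mul_bounded_linear[of A]]
  by (auto simp: mult.commute)

lemma matpow_commute: "A ** matpow A l = matpow A l ** A"
  by (induction l) (auto simp: matrix_mul_assoc)

lemma matpow_bound:
  fixes A :: "real^'n^'n"
  obtains M where "M > 0" "\<And>l v. norm (matpow A l *v v) \<le> M ^ l * norm v"
proof -
  obtain M where M: "M > 0" "\<And>v. norm (A *v v) \<le> M * norm v"
    using norm_matrix_vector_mult_le[of A] by blast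
  have "norm (matpow A l *v v) \<le> M ^ l * norm v" for l v
  proof (induction l)
    case (Suc l)
    have "norm (matpow A (Suc l) *v v) \<le> M * norm (matpow A l *v v)"
      using M by (simp add: matrix_vector_mul_assoc[symmetric])
    also have "\<dots> \<le> M * (M ^ l * norm v)"
      using Suc M by (intro mult_left_mono) auto
    finally show ?case by simp
  qed auto
  with M show ?thesis by (intro that)
qed

text \<open>Ratio test: with z = \<alpha> l + q, consecutive terms have ratio y Gamma(z) / Gamma(z +
  \<alpha>), which tends to 0.\<close>

lemma summable_Gamma_power:
  fixes x q \<alpha> :: real
  assumes "\<alpha> > 0" "q > 0"
  shows "summable (\<lambda>l. x ^ l / Gamma (\<alpha> * real l + q))"
proof -
  \<comment> \<open>A positive majorant of |x|, so that the threshold 1 / (2 y) makes sense even for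
    x = 0.\<close>
  define y where "y = \<bar>x\<bar> + 1"
  have y: "y > 0" "\<bar>x\<bar> \<le> y" by (auto simp: y_def)
  have pos: "\<alpha> * real l + q > 0" for l using assms by (auto intro: add_nonneg_pos)
  have lim: "(\<lambda>l. Gamma (\<alpha> * real l + q) / Gamma (\<alpha> * real l + q + \<alpha>)) \<longlonglongrightarrow> 0"
  proof (rule filterlim_compose[OF Gamma_shift_ratio_tendsto_0[OF assms(1)]])
    show "LIM l sequentially. \<alpha> * real l + q :> at_top"
      using assms by real_asymp
  qed
  have "\<forall>\<^sub>F l in sequentially. Gamma (\<alpha> * real l + q) / Gamma (\<alpha> * real l + q + \<alpha>) < 1 / (2 * y)"
    using lim y by (intro order_tendstoD) auto
  then obtain N where N: "\<And>l. l \<ge> N \<Longrightarrow> Gamma (\<alpha> * real l + q) / Gamma (\<alpha> * real l + q + \<alpha>) < 1 / (2 * y)"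
    by (auto simp: eventually_at_top_linorder)
  have "summable (\<lambda>l. y ^ l / Gamma (\<alpha> * real l + q))"
  proof (rule summable_ratio_test[where c="1/2" and N=N])
    fix l assume "l \<ge> N"
    have eq: "\<alpha> * real (Suc l) + q = \<alpha> * real l + q + \<alpha>" by (simp add: algebra_simps)
    have p: "Gamma (\<alpha> * real l + q) > 0" "Gamma (\<alpha> * real l + q + \<alpha>) > 0"
      using pos[of l] assms by auto
    then have "2 * y * Gamma (\<alpha> * real l + q) < Gamma (\<alpha> * real l + q + \<alpha>)"
      using N[OF \<open>l \<ge> N\<close>] y by (simp add: field_simps)
    then have "y / Gamma (\<alpha> * real l + q + \<alpha>) \<le> 1 / (2 * Gamma (\<alpha> * real l + q))"
      using p by (simp add: field_simps)
    then have "y ^ l * (y / Gamma (\<alpha> * real l + q + \<alpha>)) \<le> y ^ l * (1 / (2 * Gamma (\<alpha> * real l + q)))"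
      using y by (intro mult_left_mono) auto
    then show "norm (y ^ Suc l / Gamma (\<alpha> * real (Suc l) + q)) \<le> 1/2 * norm (y ^ l / Gamma (\<alpha> * real l + q))"
      using y p unfolding eq by (simp add: ac_simps)
  qed auto
  then show ?thesis
  proof (rule summable_comparison_test'[where N=0])
    fix l show "norm (x ^ l / Gamma (\<alpha> * real l + q)) \<le> y ^ l / Gamma (\<alpha> * real l + q)"
      using pos[of l] y by (auto simp: power_abs intro!: divide_right_mono power_mono)
  qed
qed

lemma summable_frac_monom:
  assumes "\<alpha> > 0" "q \<ge> 0" "t \<ge> 0"
  shows "summable (\<lambda>l. M ^ l * frac_monom (q + \<alpha> * real l) t)"
proof (cases "t = 0")
  case True
  then have "M ^ l * frac_monom (q + \<alpha> * real l) t = 0" if "l \<notin> {0}" for l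
    using assms that by (simp add: frac_monom_at_0 add_nonneg_pos)
  then show ?thesis by (intro summable_finite[of "{0}"]) auto
next
  case False
  with assms have t: "t > 0" by auto
  have "summable (\<lambda>l. t powr q * ((M * t powr \<alpha>) ^ l / Gamma (\<alpha> * real l + (q + 1))))"
    using assms by (intro summable_mult summable_Gamma_power) auto
  also have "(\<lambda>l. t powr q * ((M * t powr \<alpha>) ^ l / Gamma (\<alpha> * real l + (q + 1)))) =
      (\<lambda>l. M ^ l * frac_monom (q + \<alpha> * real l) t)"
  proof
    fix l
    have "t powr (q + \<alpha> * real l) = t powr q * (t powr \<alpha>) ^ l"
      using t by (simp add: powr_add powr_powr powr_realpow[symmetric])
    then show "t powr q * ((M * t powr \<alpha>) ^ l / Gamma (\<alpha> * real l + (q + 1))) =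
        M ^ l * frac_monom (q + \<alpha> * real l) t"
      using t by (simp add: frac_monom_eq power_mult_distrib ac_simps)
  qed
  finally show ?thesis .
qed

text \<open>For s > 0 this is s^q E(A s^\<alpha>) w, where E is the two-parameter Mittag-Leffler
  function with parameters \<alpha> and q + 1. The factor s^q is absorbed so that fractional
  integration and differentiation only shift q.\<close>

definition mittag_leffler :: "real \<Rightarrow> real^'n^'n \<Rightarrow> real \<Rightarrow> real^'n \<Rightarrow> real \<Rightarrow> real^'n" where
  "mittag_leffler \<alpha> A q w s = (\<Sum>l. frac_monom (q + \<alpha> * real l) s *\<^sub>R (matpow A l *v w))"

context
  fixes \<alpha> :: real and A :: "real^'n^'n"
  assumes \<alpha>: "\<alpha> > 0"
begin

lemma mittag_leffler_uniform_limit: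
  assumes "q \<ge> 0" "t \<ge> 0"
  shows "uniform_limit {0..t} (\<lambda>n s. \<Sum>l<n. frac_monom (q + \<alpha> * real l) s *\<^sub>R (matpow A l *v w))
           (mittag_leffler \<alpha> A q w) sequentially"
proof -
  obtain M where M: "M > 0" "\<And>l v. norm (matpow A l *v v) \<le> M ^ l * norm v"
    using matpow_bound[of A] by blast
  show ?thesis
    unfolding mittag_leffler_def
  proof (rule Weierstrass_m_test)
    show "summable (\<lambda>l. M ^ l * frac_monom (q + \<alpha> * real l) t * norm w)"
      using assms \<alpha> by (intro summable_mult2 summable_frac_monom) auto
    fix l s assume s: "s \<in> {0..t}"
    have "norm (frac_monom (q + \<alpha> * real l) s *\<^sub>R (matpow A l *v w)) = frac_monom (q + \<alpha> * real l) s * norm (matpow A l *v w)"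
      using assms \<alpha> by (simp add: frac_monom_nonneg)
    also have "\<dots> \<le> frac_monom (q + \<alpha> * real l) t * (M ^ l * norm w)"
      using assms \<alpha> M s by (intro mult_mono frac_monom_mono frac_monom_nonneg) auto
    finally show "norm (frac_monom (q + \<alpha> * real l) s *\<^sub>R (matpow A l *v w)) \<le> M ^ l * frac_monom (q + \<alpha> * real l) t * norm w"
      by (simp add: ac_simps)
  qed
qed

lemma mittag_leffler_sums:
  assumes "q \<ge> 0" "s \<ge> 0"
  shows "(\<lambda>l. frac_monom (q + \<alpha> * real l) s *\<^sub>R (matpow A l *v w)) sums mittag_leffler \<alpha> A q w s"
  unfolding sums_def by (rule tendsto_uniform_limitI[OF mittag_leffler_uniform_limit[OF assms]]) (use assms in auto)

lemma continuous_on_mittag_leffler: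
  assumes "q \<ge> 0"
  shows "continuous_on {0..t} (mittag_leffler \<alpha> A q w)"
proof (cases "t \<ge> 0")
  case True
  have "continuous_on {0..t} (\<lambda>s. \<Sum>l<n. frac_monom (q + \<alpha> * real l) s *\<^sub>R (matpow A l *v w))" for n
    using assms \<alpha> by (intro continuous_on_sum continuous_on_scaleR continuous_on_frac_monom continuous_on_const) auto
  then show ?thesis
    by (intro uniform_limit_theorem[OF _ mittag_leffler_uniform_limit[OF assms True]] always_eventually) auto
qed auto

text \<open>The term l = 0 is split off. Together with \<open>mittag_leffler_mult\<close> this says
  that lowering the index by \<alpha> yields A times the series plus one monomial, the differential
  equation in series form.\<close>

lemma mittag_leffler_split:
  assumes "q \<ge> 0" "s \<ge> 0"
  shows "mittag_leffler \<alpha> A q w s = frac_monom q s *\<^sub>R w + mittag_leffler \<alpha> A (q + \<alpha>) (A *v w) s"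
proof -
  have "(\<lambda>l. frac_monom (q + \<alpha> + \<alpha> * real l) s *\<^sub>R (matpow A l *v (A *v w))) sums mittag_leffler \<alpha> A (q + \<alpha>) (A *v w) s"
    using assms \<alpha> by (intro mittag_leffler_sums) auto
  then have "(\<lambda>l. frac_monom (q + \<alpha> * real (Suc l)) s *\<^sub>R (matpow A (Suc l) *v w)) sums mittag_leffler \<alpha> A (q + \<alpha>) (A *v w) s"
    by (simp add: matrix_vector_mul_assoc matpow_commute algebra_simps)
  then have "(\<lambda>l. frac_monom (q + \<alpha> * real l) s *\<^sub>R (matpow A l *v w)) sums
     (mittag_leffler \<alpha> A (q + \<alpha>) (A *v w) s + frac_monom q s *\<^sub>R w)"
    by (subst (asm) sums_Suc_iff) simp
  from sums_unique2[OF mittag_leffler_sums[OF assms] this] show ?thesis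
    by (simp add: add.commute)
qed

lemma mittag_leffler_mult:
  assumes "q \<ge> 0" "s \<ge> 0"
  shows "mittag_leffler \<alpha> A q (A *v w) s = A *v mittag_leffler \<alpha> A q w s"
proof -
  have "(\<lambda>l. A *v (frac_monom (q + \<alpha> * real l) s *\<^sub>R (matpow A l *v w))) sums (A *v mittag_leffler \<alpha> A q w s)"
    by (intro bounded_linear.sums[OF matrix_vector_mul_bounded_linear] mittag_leffler_sums assms)
  also have "(\<lambda>l. A *v (frac_monom (q + \<alpha> * real l) s *\<^sub>R (matpow A l *v w))) =
     (\<lambda>l. frac_monom (q + \<alpha> * real l) s *\<^sub>R (matpow A l *v (A *v w)))"
    by (simp add: matrix_vector_mult_scaleR matrix_vector_mul_assoc matpow_commute)
  finally show ?thesis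
    by (rule sums_unique2[OF mittag_leffler_sums[OF assms]])
qed

lemma mittag_leffler_at_0:
  assumes "q > 0"
  shows "mittag_leffler \<alpha> A q w 0 = 0"
  using assms \<alpha> by (simp add: mittag_leffler_def frac_monom_at_0 add_pos_nonneg)

text \<open>Termwise differentiation; \<open>q \<ge> 1\<close> makes every exponent at least 1 and
  gives the derived series the index q - 1 \<ge> 0, where its uniform convergence is known.\<close>

lemma mittag_leffler_has_derivative:
  assumes "q \<ge> 1" "s \<in> {0..t}"
  shows "(mittag_leffler \<alpha> A q w has_vector_derivative mittag_leffler \<alpha> A (q - 1) w s) (at s within {0..t})"
proof -
  have t: "t \<ge> 0" using assms by auto
  define f where "f = (\<lambda>l s. frac_monom (q + \<alpha> * real l) s *\<^sub>R (matpow A l *v w))"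
  define f' where "f' = (\<lambda>l s. frac_monom (q - 1 + \<alpha> * real l) s *\<^sub>R (matpow A l *v w))"
  have "\<exists>g. \<forall>x\<in>{0..t}. (\<lambda>n. f n x) sums g x \<and> (g has_derivative (\<lambda>h. h *\<^sub>R mittag_leffler \<alpha> A (q - 1) w x)) (at x within {0..t})"
  proof (rule has_derivative_series[where f'="\<lambda>n x h. h *\<^sub>R f' n x"])
    show "(f n has_derivative (\<lambda>h. h *\<^sub>R f' n x)) (at x within {0..t})" if "x \<in> {0..t}" for n x
    proof -
      have "(frac_monom (q + \<alpha> * real n) has_vector_derivative frac_monom (q + \<alpha> * real n - 1) x) (at x within {0..t})"
        using assms \<alpha> that by (intro frac_monom_has_derivative) (auto intro: add_increasing2)
      then have "((\<lambda>s. frac_monom (q + \<alpha> * real n) s *\<^sub>R (matpow A n *v w)) has_vector_derivative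
          frac_monom (q + \<alpha> * real n - 1) x *\<^sub>R (matpow A n *v w)) (at x within {0..t})"
        by (auto intro!: derivative_eq_intros simp: has_real_derivative_iff_has_vector_derivative)
      then show ?thesis
        by (simp add: f_def f'_def has_vector_derivative_def algebra_simps)
    qed
    have ul: "uniform_limit {0..t} (\<lambda>n s. \<Sum>l<n. f' l s) (mittag_leffler \<alpha> A (q - 1) w) sequentially"
      unfolding f'_def using assms t by (intro mittag_leffler_uniform_limit) auto
    show "\<forall>\<^sub>F n in sequentially. \<forall>x\<in>{0..t}. \<forall>h. norm ((\<Sum>i<n. h *\<^sub>R f' i x) - h *\<^sub>R mittag_leffler \<alpha> A (q - 1) w x) \<le> e * norm h"
      if "e > 0" for e
      using uniform_limitD[OF ul that]
    proof eventually_elim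
      case (elim n)
      show ?case
      proof (intro ballI allI)
        fix x h assume "x \<in> {0..t}"
        then have "norm ((\<Sum>l<n. f' l x) - mittag_leffler \<alpha> A (q - 1) w x) \<le> e"
          using elim by (auto simp: dist_norm intro: less_imp_le)
        then have "\<bar>h\<bar> * norm ((\<Sum>l<n. f' l x) - mittag_leffler \<alpha> A (q - 1) w x) \<le> \<bar>h\<bar> * e"
          by (intro mult_left_mono) auto
        then show "norm ((\<Sum>i<n. h *\<^sub>R f' i x) - h *\<^sub>R mittag_leffler \<alpha> A (q - 1) w x) \<le> e * norm h"
          by (simp add: scaleR_sum_right[symmetric] scaleR_diff_right[symmetric] mult.commute)
      qed
    qed
    show "(\<lambda>n. f n s) sums mittag_leffler \<alpha> A q w s"
      unfolding f_def using assms by (intro mittag_leffler_sums) auto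
  qed (use assms in auto)
  then obtain g where g: "\<And>x. x \<in> {0..t} \<Longrightarrow> (\<lambda>n. f n x) sums g x"
      "\<And>x. x \<in> {0..t} \<Longrightarrow> (g has_vector_derivative mittag_leffler \<alpha> A (q - 1) w x) (at x within {0..t})"
    unfolding has_vector_derivative_def by blast
  have "g x = mittag_leffler \<alpha> A q w x" if "x \<in> {0..t}" for x
  proof -
    have "(\<lambda>n. f n x) sums mittag_leffler \<alpha> A q w x"
      unfolding f_def using assms that by (intro mittag_leffler_sums) auto
    then show ?thesis using sums_unique2[OF g(1)[OF that]] by simp
  qed
  then show ?thesis
    by (intro has_vector_derivative_transform[OF assms(2) _ g(2)[OF assms(2)]]) simp
qed

lemma frac_integral_mittag_leffler:
  assumes "q \<ge> 0" "\<beta> \<ge> 0" "s \<ge> 0"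
  shows "frac_integral \<beta> (mittag_leffler \<alpha> A q w) s = mittag_leffler \<alpha> A (q + \<beta>) w s"
proof -
  let ?f = "\<lambda>n s. \<Sum>l<n. frac_monom (q + \<alpha> * real l) s *\<^sub>R (matpow A l *v w)"
  have "uniform_limit {0..s} (\<lambda>n. frac_integral \<beta> (?f n)) (frac_integral \<beta> (mittag_leffler \<alpha> A q w)) sequentially"
  proof (rule uniform_limit_frac_integral[OF mittag_leffler_uniform_limit])
    show "continuous_on {0..s} (?f n)" for n
      using assms \<alpha> by (intro continuous_on_sum continuous_on_scaleR continuous_on_frac_monom continuous_on_const) auto
  qed (use assms continuous_on_mittag_leffler in auto)
  then have "(\<lambda>n. frac_integral \<beta> (?f n) s) \<longlonglongrightarrow> frac_integral \<beta> (mittag_leffler \<alpha> A q w) s"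
    by (rule tendsto_uniform_limitI) (use assms in auto)
  also have "(\<lambda>n. frac_integral \<beta> (?f n) s) = (\<lambda>n. \<Sum>l<n. frac_monom (q + \<beta> + \<alpha> * real l) s *\<^sub>R (matpow A l *v w))"
  proof
    fix n
    have "frac_integral \<beta> (?f n) s = (\<Sum>l<n. frac_integral \<beta> (\<lambda>s. frac_monom (q + \<alpha> * real l) s *\<^sub>R (matpow A l *v w)) s)"
      using assms \<alpha> by (intro frac_integral_sum[where t=s] continuous_on_scaleR continuous_on_frac_monom continuous_on_const) auto
    also have "\<dots> = (\<Sum>l<n. frac_monom (q + \<beta> + \<alpha> * real l) s *\<^sub>R (matpow A l *v w))"
      using assms \<alpha> by (simp add: frac_integral_frac_monom add_ac)
    finally show "frac_integral \<beta> (?f n) s = (\<Sum>l<n. frac_monom (q + \<beta> + \<alpha> * real l) s *\<^sub>R (matpow A l *v w))" .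
  qed
  finally have "(\<lambda>l. frac_monom (q + \<beta> + \<alpha> * real l) s *\<^sub>R (matpow A l *v w)) sums frac_integral \<beta> (mittag_leffler \<alpha> A q w) s"
    by (simp add: sums_def)
  from sums_unique2[OF this mittag_leffler_sums] show ?thesis
    using assms by simp
qed

end

section \<open>Controllability from the Kalman condition\<close>

text \<open>\<open>nderiv\<close> is built on \<open>vector_derivative\<close>, a choice operator;
  listing candidate derivatives explicitly allows them to be added and scaled before any uniqueness
  argument.\<close>

definition deriv_chain :: "real set \<Rightarrow> nat \<Rightarrow> (nat \<Rightarrow> real \<Rightarrow> 'a::real_normed_vector) \<Rightarrow> bool" where
  "deriv_chain S r D \<longleftrightarrow> (\<forall>j<r. \<forall>s\<in>S. (D j has_vector_derivative D (Suc j) s) (at s within S))"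

text \<open>Induction on j. Derivatives within [0,t] are unique because t > 0; on a degenerate
  interval \<open>vector_derivative\<close> would be arbitrary.\<close>

lemma nderiv_deriv_chain:
  fixes D :: "nat \<Rightarrow> real \<Rightarrow> 'a::real_normed_vector"
  assumes "deriv_chain {0..t} r D" "t > 0" "\<And>s. s \<in> {0..t} \<Longrightarrow> f s = D 0 s" "j \<le> r" "s \<in> {0..t}"
  shows "nderiv {0..t} j f s = D j s"
  using assms(4,5)
proof (induction j arbitrary: s)
  case (Suc j)
  have "(D j has_vector_derivative D (Suc j) s) (at s within {0..t})"
    using assms(1) Suc.prems by (auto simp: deriv_chain_def)
  then have "(nderiv {0..t} j f has_vector_derivative D (Suc j) s) (at s within {0..t})"
    by (rule has_vector_derivative_transform[rotated 2]) (use Suc in auto)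
  then show ?case
    using assms(2) Suc.prems vector_derivative_within_cbox[of 0 t s] by simp
qed (use assms in auto)

lemma nderiv_has_vector_derivative_deriv_chain:
  fixes D :: "nat \<Rightarrow> real \<Rightarrow> 'a::real_normed_vector"
  assumes "deriv_chain {0..t} r D" "t > 0" "\<And>s. s \<in> {0..t} \<Longrightarrow> f s = D 0 s" "j < r" "s \<in> {0..t}"
  shows "(nderiv {0..t} j f has_vector_derivative D (Suc j) s) (at s within {0..t})"
proof -
  have "(D j has_vector_derivative D (Suc j) s) (at s within {0..t})"
    using assms by (auto simp: deriv_chain_def)
  then show ?thesis
    by (rule has_vector_derivative_transform[rotated 2]) (use assms nderiv_deriv_chain[OF assms(1-3)] in auto)
qed

lemma times_differentiable_deriv_chain:
  assumes "deriv_chain {0..t} r D" "t > 0" "\<And>s. s \<in> {0..t} \<Longrightarrow> f s = D 0 s" "r' \<le> r"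
  shows "times_differentiable_on r' f {0..t}"
  unfolding times_differentiable_on_def
  using nderiv_has_vector_derivative_deriv_chain[OF assms(1-3)] assms(4)
  by (meson differentiableI_vector less_le_trans)

lemma deriv_chain_add:
  "deriv_chain S r D \<Longrightarrow> deriv_chain S r E \<Longrightarrow> deriv_chain S r (\<lambda>j s. D j s + E j s)"
  by (auto simp: deriv_chain_def intro!: has_vector_derivative_add)

lemma deriv_chain_scaleR:
  "deriv_chain S r D \<Longrightarrow> deriv_chain S r (\<lambda>j s. c *\<^sub>R D j s)"
  unfolding deriv_chain_def
  using bounded_linear.has_vector_derivative[OF bounded_linear_scaleR_right] by blast

text \<open>For t > 0 and k > 0 this strengthens \<open>caputo_solution\<close>: both derivative
  sequences are explicit witnesses, the Taylor polynomial uses \<open>x0\<close> directly, and the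
  equation holds on all of [0,t]. In this form superposition is immediate, every ingredient being
  linear in (u, x0, x).\<close>

definition chain_solution ::
    "real \<Rightarrow> nat \<Rightarrow> real^'n^'n \<Rightarrow> real^'m^'n \<Rightarrow> real \<Rightarrow>
     (real \<Rightarrow> real^'m) \<Rightarrow> (nat \<Rightarrow> real^'n) \<Rightarrow> (real \<Rightarrow> real^'n) \<Rightarrow> bool" where
  "chain_solution \<alpha> k A B t u x0 x \<longleftrightarrow> continuous_on {0..t} x \<and>
    (\<exists>X. deriv_chain {0..t} (k - 1) X \<and> continuous_on {0..t} (X (k - 1)) \<and>
         (\<forall>s\<in>{0..t}. x s = X 0 s) \<and> (\<forall>j<k. X j 0 = x0 j)) \<and>
    (\<exists>Y. deriv_chain {0..t} k Y \<and>
         (\<forall>s\<in>{0..t}. frac_integral (real k - \<alpha>) (\<lambda>s. x s - (\<Sum>j<k. (s ^ j / fact j) *\<^sub>R x0 j)) s = Y 0 s) \<and>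
         (\<forall>s\<in>{0..t}. Y k s = A *v x s + B *v u s))"

lemma chain_solution_imp_caputo_solution:
  assumes "chain_solution \<alpha> k A B t u x0 x" "t > 0" "k > 0"
  shows "caputo_solution \<alpha> k A B t u x0 x"
proof -
  obtain X where X: "deriv_chain {0..t} (k - 1) X" "continuous_on {0..t} (X (k - 1))"
      "\<And>s. s \<in> {0..t} \<Longrightarrow> x s = X 0 s" "\<And>j. j < k \<Longrightarrow> X j 0 = x0 j"
    using assms(1) by (auto simp: chain_solution_def)
  let ?y = "frac_integral (real k - \<alpha>) (\<lambda>s. x s - (\<Sum>j<k. (s ^ j / fact j) *\<^sub>R x0 j))"
  obtain Y where Y: "deriv_chain {0..t} k Y" "\<And>s. s \<in> {0..t} \<Longrightarrow> ?y s = Y 0 s"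
      "\<And>s. s \<in> {0..t} \<Longrightarrow> Y k s = A *v x s + B *v u s"
    using assms(1) by (auto simp: chain_solution_def)
  have nx: "nderiv {0..t} j x s = X j s" if "j < k" "s \<in> {0..t}" for j s
    using nderiv_deriv_chain[OF X(1) assms(2) X(3)] that by auto
  have Ck: "Ck_on (k - 1) x {0..t}"
    unfolding Ck_on_def
  proof
    show "times_differentiable_on (k - 1) x {0..t}"
      using times_differentiable_deriv_chain[OF X(1) assms(2) X(3)] by auto
    show "continuous_on {0..t} (nderiv {0..t} (k - 1) x)"
      using nx assms by (intro continuous_on_eq[OF X(2)]) auto
  qed
  have ic: "nderiv {0..t} j x 0 = x0 j" if "j < k" for j
    using nx[OF that, of 0] X(4)[OF that] assms by auto
  have "(\<lambda>s. x s - (\<Sum>j<k. (s ^ j / fact j) *\<^sub>R nderiv {0..t} j x 0)) = (\<lambda>s. x s - (\<Sum>j<k. (s ^ j / fact j) *\<^sub>R x0 j))"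
    using ic by (auto intro!: sum.cong)
  moreover have "times_differentiable_on (k - 1) ?y {0..t}"
    using times_differentiable_deriv_chain[OF Y(1) assms(2) Y(2)] by auto
  moreover have "(nderiv {0..t} (k - 1) ?y has_vector_derivative A *v x \<tau> + B *v u \<tau>) (at \<tau> within {0..t})"
    if "\<tau> \<in> {0..t}" for \<tau>
    using nderiv_has_vector_derivative_deriv_chain[OF Y(1) assms(2) Y(2), of "k - 1" \<tau>]
    unfolding Y(3)[OF that, symmetric] using assms that by simp
  ultimately have "has_caputo_derivative \<alpha> k t x (A *v x \<tau> + B *v u \<tau>) \<tau>" if "\<tau> \<in> {0..t}" for \<tau>
    using that by (simp add: has_caputo_derivative_def Let_def)
  with Ck ic show ?thesis
    by (auto simp: caputo_solution_def)
qed

lemma chain_solution_add: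
  assumes "chain_solution \<alpha> k A B t u x0 x" "chain_solution \<alpha> k A B t u' x0' x'" "\<alpha> \<le> real k"
  shows "chain_solution \<alpha> k A B t (\<lambda>s. u s + u' s) (\<lambda>j. x0 j + x0' j) (\<lambda>s. x s + x' s)"
proof -
  have c: "continuous_on {0..t} x" "continuous_on {0..t} x'"
    using assms by (auto simp: chain_solution_def)
  obtain X where X: "deriv_chain {0..t} (k - 1) X" "continuous_on {0..t} (X (k - 1))"
      "\<And>s. s \<in> {0..t} \<Longrightarrow> x s = X 0 s" "\<And>j. j < k \<Longrightarrow> X j 0 = x0 j"
    using assms(1) by (auto simp: chain_solution_def)
  obtain X' where X': "deriv_chain {0..t} (k - 1) X'" "continuous_on {0..t} (X' (k - 1))"
      "\<And>s. s \<in> {0..t} \<Longrightarrow> x' s = X' 0 s" "\<And>j. j < k \<Longrightarrow> X' j 0 = x0' j"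
    using assms(2) by (auto simp: chain_solution_def)
  let ?f = "\<lambda>x x0 s. x s - (\<Sum>j<k. (s ^ j / fact j) *\<^sub>R x0 j) :: real^'n"
  obtain Y where Y: "deriv_chain {0..t} k Y" "\<And>s. s \<in> {0..t} \<Longrightarrow> frac_integral (real k - \<alpha>) (?f x x0) s = Y 0 s"
      "\<And>s. s \<in> {0..t} \<Longrightarrow> Y k s = A *v x s + B *v u s"
    using assms(1) by (auto simp: chain_solution_def)
  obtain Y' where Y': "deriv_chain {0..t} k Y'" "\<And>s. s \<in> {0..t} \<Longrightarrow> frac_integral (real k - \<alpha>) (?f x' x0') s = Y' 0 s"
      "\<And>s. s \<in> {0..t} \<Longrightarrow> Y' k s = A *v x' s + B *v u' s"
    using assms(2) by (auto simp: chain_solution_def)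
  have "frac_integral (real k - \<alpha>) (?f (\<lambda>s. x s + x' s) (\<lambda>j. x0 j + x0' j)) s = Y 0 s + Y' 0 s"
    if "s \<in> {0..t}" for s
  proof -
    have "frac_integral (real k - \<alpha>) (?f (\<lambda>s. x s + x' s) (\<lambda>j. x0 j + x0' j)) s =
        frac_integral (real k - \<alpha>) (\<lambda>s. ?f x x0 s + ?f x' x0' s) s"
      using that by (intro frac_integral_cong) (auto simp: scaleR_add_right sum.distrib)
    also have "\<dots> = Y 0 s + Y' 0 s"
      using that assms(3) c Y(2) Y'(2) by (subst frac_integral_add[where t=t]) (auto intro!: continuous_intros)
    finally show ?thesis .
  qed
  then show ?thesis
    unfolding chain_solution_def
    using c X X' Y Y'
    by (intro conjI exI[of _ "\<lambda>j s. X j s + X' j s"] exI[of _ "\<lambda>j s. Y j s + Y' j s"])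
       (auto intro!: deriv_chain_add continuous_intros simp: matrix_vector_right_distrib)
qed

lemma chain_solution_scaleR:
  assumes "chain_solution \<alpha> k A B t u x0 x"
  shows "chain_solution \<alpha> k A B t (\<lambda>s. c *\<^sub>R u s) (\<lambda>j. c *\<^sub>R x0 j) (\<lambda>s. c *\<^sub>R x s)"
proof -
  obtain X where X: "deriv_chain {0..t} (k - 1) X" "continuous_on {0..t} (X (k - 1))"
      "\<And>s. s \<in> {0..t} \<Longrightarrow> x s = X 0 s" "\<And>j. j < k \<Longrightarrow> X j 0 = x0 j"
    using assms(1) by (auto simp: chain_solution_def)
  let ?f = "\<lambda>x x0 s. x s - (\<Sum>j<k. (s ^ j / fact j) *\<^sub>R x0 j) :: real^'n"
  obtain Y where Y: "deriv_chain {0..t} k Y" "\<And>s. s \<in> {0..t} \<Longrightarrow> frac_integral (real k - \<alpha>) (?f x x0) s = Y 0 s"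
      "\<And>s. s \<in> {0..t} \<Longrightarrow> Y k s = A *v x s + B *v u s"
    using assms(1) by (auto simp: chain_solution_def)
  have "?f (\<lambda>s. c *\<^sub>R x s) (\<lambda>j. c *\<^sub>R x0 j) = (\<lambda>s. c *\<^sub>R ?f x x0 s)"
    by (auto simp: scaleR_diff_right scaleR_sum_right mult.commute)
  then have "frac_integral (real k - \<alpha>) (?f (\<lambda>s. c *\<^sub>R x s) (\<lambda>j. c *\<^sub>R x0 j)) s = c *\<^sub>R Y 0 s"
    if "s \<in> {0..t}" for s
    using Y(2)[OF that] by (simp only: frac_integral_scaleR)
  moreover have "continuous_on {0..t} x"
    using assms by (auto simp: chain_solution_def)
  ultimately show ?thesis
    unfolding chain_solution_def
    using X Y
    by (intro conjI exI[of _ "\<lambda>j s. c *\<^sub>R X j s"] exI[of _ "\<lambda>j s. c *\<^sub>R Y j s"])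
       (auto intro!: deriv_chain_scaleR continuous_intros simp: matrix_vector_mult_scaleR scaleR_add_right)
qed

lemma chain_solution_zero:
  assumes "\<alpha> \<le> real k"
  shows "chain_solution \<alpha> k A B t (\<lambda>_. 0) (\<lambda>_. 0) (\<lambda>_. 0)"
  unfolding chain_solution_def
  by (intro conjI exI[of _ "\<lambda>j s. 0"]) (auto simp: deriv_chain_def frac_integral_def)

lemma chain_solution_sum:
  assumes "\<And>i. i \<in> I \<Longrightarrow> chain_solution \<alpha> k A B t (u i) (x0 i) (x i)" "finite I" "\<alpha> \<le> real k"
  shows "chain_solution \<alpha> k A B t (\<lambda>s. \<Sum>i\<in>I. u i s) (\<lambda>j. \<Sum>i\<in>I. x0 i j) (\<lambda>s. \<Sum>i\<in>I. x i s)"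
  using assms(2,1)
proof (induction I)
  case (insert i I)
  then show ?case
    using chain_solution_add[of \<alpha> k A B t "u i" "x0 i" "x i"] assms(3) by simp
qed (use chain_solution_zero assms in auto)

section \<open>Explicit solutions as Mittag-Leffler series\<close>

context
  fixes \<alpha> :: real and k :: nat and A :: "real^'n^'n" and t :: real
  assumes \<alpha>: "\<alpha> > 0" and k: "0 < k" "real k - 1 < \<alpha>" "\<alpha> \<le> real k"
begin

lemma deriv_chain_mittag_leffler:
  assumes "q \<ge> real r"
  shows "deriv_chain {0..t} r (\<lambda>j. mittag_leffler \<alpha> A (q - real j) w)"
  unfolding deriv_chain_def
proof safe
  fix j s assume "j < r" "s \<in> {0..t}"
  then show "(mittag_leffler \<alpha> A (q - real j) w has_vector_derivative mittag_leffler \<alpha> A (q - real (Suc j)) w s) (at s within {0..t})"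
    using mittag_leffler_has_derivative[OF \<alpha>, of "q - real j" s t A w] assms by (simp add: algebra_simps)
qed

text \<open>Integration of order k - \<alpha> raises the index \<alpha> + c to k + c, and k
  derivatives lower it to c; splitting off the first term there gives the control term plus A times
  the state.\<close>

lemma chain_solution_control:
  fixes B :: "real^'m^'n"
  shows "chain_solution \<alpha> k A B t (\<lambda>s. frac_monom (real c) s *\<^sub>R e) (\<lambda>_. 0) (mittag_leffler \<alpha> A (\<alpha> + real c) (B *v e))"
  unfolding chain_solution_def
proof (intro conjI exI ballI allI impI)
  let ?w = "B *v e"
  show "deriv_chain {0..t} (k - 1) (\<lambda>j. mittag_leffler \<alpha> A (\<alpha> + real c - real j) ?w)"
    using k by (intro deriv_chain_mittag_leffler) auto
  show "continuous_on {0..t} (mittag_leffler \<alpha> A (\<alpha> + real c - real (k - 1)) ?w)"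
    using k by (intro continuous_on_mittag_leffler \<alpha>) auto
  \<comment> \<open>The index stays positive because j \<le> k - 1 < \<alpha>.\<close>
  show "mittag_leffler \<alpha> A (\<alpha> + real c - real j) ?w 0 = 0" if "j < k" for j
    using k that by (intro mittag_leffler_at_0 \<alpha>) auto
  show "deriv_chain {0..t} k (\<lambda>j. mittag_leffler \<alpha> A (real k + real c - real j) ?w)"
    by (intro deriv_chain_mittag_leffler) auto
  show "frac_integral (real k - \<alpha>) (\<lambda>s. mittag_leffler \<alpha> A (\<alpha> + real c) ?w s - (\<Sum>j<k. (s ^ j / fact j) *\<^sub>R 0)) s =
      mittag_leffler \<alpha> A (real k + real c - real 0) ?w s" if "s \<in> {0..t}" for s
    using \<alpha> k that frac_integral_mittag_leffler[OF \<alpha>, of "\<alpha> + real c" "real k - \<alpha>" s A ?w] by (simp add: add.commute)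
  show "mittag_leffler \<alpha> A (real k + real c - real k) ?w s =
      A *v mittag_leffler \<alpha> A (\<alpha> + real c) ?w s + B *v (frac_monom (real c) s *\<^sub>R e)" if "s \<in> {0..t}" for s
    using \<alpha> that mittag_leffler_split[OF \<alpha>, of "real c" s A ?w] mittag_leffler_mult[OF \<alpha>, of "real c + \<alpha>" s A ?w]
    by (simp add: matrix_vector_mult_scaleR add.commute)
qed (use \<alpha> in \<open>auto intro!: continuous_on_mittag_leffler\<close>)

text \<open>The state is (s^i / i!) w plus the series of index \<alpha> + i in A w. Subtracting the
  Taylor polynomial removes the first part; the rest, integrated to order k - \<alpha> and
  differentiated k times, becomes A times the state.\<close>

lemma chain_solution_initial:
  fixes B :: "real^'m^'n"
  assumes "i < k"
  shows "chain_solution \<alpha> k A B t (\<lambda>_. 0) (\<lambda>j. if j = i then w else 0) (mittag_leffler \<alpha> A (real i) w)"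
  unfolding chain_solution_def
proof (intro conjI exI ballI allI impI)
  \<comment> \<open>\<open>P j\<close> is the j-th derivative of the monomial part; it is set to 0
    for j > i, where the exponent i - j would be negative.\<close>
  define P where "P = (\<lambda>j s. if j \<le> i then frac_monom (real i - real j) s *\<^sub>R w else 0)"
  let ?w = "A *v w"
  have "deriv_chain {0..t} (k - 1) P"
    unfolding deriv_chain_def
  proof safe
    fix j s assume "j < k - 1" "s \<in> {0..t}"
    consider "j < i" | "j = i" | "j > i" by linarith
    then show "(P j has_vector_derivative P (Suc j) s) (at s within {0..t})"
    proof cases
      case 1
      have "(frac_monom (real i - real j) has_vector_derivative frac_monom (real i - real j - 1) s) (at s within {0..t})"
        using 1 \<open>s \<in> {0..t}\<close> by (intro frac_monom_has_derivative) auto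
      then show ?thesis
        using 1 by (auto simp: P_def has_real_derivative_iff_has_vector_derivative algebra_simps intro!: derivative_eq_intros)
    qed (auto simp: P_def frac_monom_def)
  qed
  then show "deriv_chain {0..t} (k - 1) (\<lambda>j s. P j s + mittag_leffler \<alpha> A (\<alpha> + real i - real j) ?w s)"
    using k by (intro deriv_chain_add deriv_chain_mittag_leffler) auto
  show "continuous_on {0..t} (\<lambda>s. P (k - 1) s + mittag_leffler \<alpha> A (\<alpha> + real i - real (k - 1)) ?w s)"
  proof (intro continuous_on_add)
    show "continuous_on {0..t} (P (k - 1))"
      unfolding P_def by (cases "k - 1 \<le> i") (auto intro!: continuous_intros continuous_on_frac_monom)
  qed (use k in \<open>auto intro!: continuous_on_mittag_leffler \<alpha>\<close>)
  have P0: "mittag_leffler \<alpha> A (real i) w s = P 0 s + mittag_leffler \<alpha> A (\<alpha> + real i) ?w s" if "s \<in> {0..t}" for s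
    using that mittag_leffler_split[OF \<alpha>, of "real i" s A w] by (simp add: P_def add.commute)
  then show "mittag_leffler \<alpha> A (real i) w s = P 0 s + mittag_leffler \<alpha> A (\<alpha> + real i - real 0) ?w s" if "s \<in> {0..t}" for s
    using that by simp
  show "P j 0 + mittag_leffler \<alpha> A (\<alpha> + real i - real j) ?w 0 = (if j = i then w else 0)" if "j < k" for j
    using k that mittag_leffler_at_0[OF \<alpha>, of "\<alpha> + real i - real j" A ?w]
    by (auto simp: P_def frac_monom_at_0) (auto simp: frac_monom_def)
  show "deriv_chain {0..t} k (\<lambda>j. mittag_leffler \<alpha> A (real k + real i - real j) ?w)"
    by (intro deriv_chain_mittag_leffler) auto
  show "frac_integral (real k - \<alpha>) (\<lambda>s. mittag_leffler \<alpha> A (real i) w s - (\<Sum>j<k. (s ^ j / fact j) *\<^sub>R (if j = i then w else 0))) s =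
      mittag_leffler \<alpha> A (real k + real i - real 0) ?w s" if "s \<in> {0..t}" for s
  proof -
    have "frac_integral (real k - \<alpha>) (\<lambda>s. mittag_leffler \<alpha> A (real i) w s - (\<Sum>j<k. (s ^ j / fact j) *\<^sub>R (if j = i then w else 0))) s =
        frac_integral (real k - \<alpha>) (mittag_leffler \<alpha> A (\<alpha> + real i) ?w) s"
      using that P0 assms by (intro frac_integral_cong) (auto simp: P_def frac_monom_nat if_distrib[of "scaleR _"] cong: if_cong)
    then show ?thesis
      using \<alpha> k that frac_integral_mittag_leffler[OF \<alpha>, of "\<alpha> + real i" "real k - \<alpha>" s A ?w] by (simp add: add.commute)
  qed
  show "mittag_leffler \<alpha> A (real k + real i - real k) ?w s = A *v mittag_leffler \<alpha> A (real i) w s + B *v 0" if "s \<in> {0..t}" for s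
    using that mittag_leffler_mult[OF \<alpha>, of "real i" s A w] by simp
qed (use \<alpha> in \<open>auto intro!: continuous_on_mittag_leffler\<close>)

end

text \<open>Each quotient is the reciprocal of a rising factorial q (q + 1) ... (q + c - 1), whose
  factors grow with q.\<close>

lemma Gamma_shift_nat_antimono:
  fixes p :: real
  assumes "p > 0" "p \<le> q"
  shows "Gamma q / Gamma (real c + q) \<le> Gamma p / Gamma (real c + p)"
proof (induction c)
  case (Suc c)
  have *: "Gamma y / Gamma (real (Suc c) + y) = (Gamma y / Gamma (real c + y)) * (1 / (real c + y))"
    if "y > 0" for y :: real
    using that Gamma_plus1_real[of "real c + y"] by (simp add: add_ac)
  have "(Gamma q / Gamma (real c + q)) * (1 / (real c + q)) \<le> (Gamma p / Gamma (real c + p)) * (1 / (real c + p))"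
    using assms by (intro mult_mono Suc) (auto simp: field_simps)
  then show ?case
    using assms *[of p] *[of q] by simp
qed (use assms in auto)

text \<open>Letting the exponent offset \<open>c\<close> tend to infinity isolates the first nonzero coefficient.\<close>

lemma frac_monom_series_coeffs_zero:
  fixes a :: "nat \<Rightarrow> real"
  assumes \<alpha>: "\<alpha> > 0" and t: "t > 0"
    and bound: "\<And>l. \<bar>a l\<bar> \<le> C * M ^ l"
    and zero: "\<And>c::nat. (\<lambda>l. frac_monom (\<alpha> + real c + \<alpha> * real l) t * a l) sums 0"
  shows "a l = 0"
proof (induction l rule: less_induct)
  case (less L)
  \<comment> \<open>In the L-th term of the series the Gamma argument is c + p; the induction
    hypothesis removes all earlier terms.\<close>
  define p where "p = \<alpha> + \<alpha> * real L + 1"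
  have p: "p > 1" using \<alpha> by (auto simp: p_def intro: add_pos_nonneg)
  \<comment> \<open>A majorant for the terms after the L-th that is free of c; the dependence on c
    is confined to the factor Gamma(c + p) / Gamma(c + p + \<alpha>).\<close>
  define D where "D = (\<lambda>j. (M * t powr \<alpha>) ^ j / Gamma (\<alpha> * real j + (p + \<alpha>)) * (C * M ^ Suc L * t powr \<alpha> * Gamma (p + \<alpha>)))"
  have "summable D"
    unfolding D_def using \<alpha> p by (intro summable_mult2 summable_Gamma_power) auto
  have le: "\<bar>a L\<bar> \<le> Gamma (real c + p) / Gamma (real c + p + \<alpha>) * suminf D" for c
  proof -
    \<comment> \<open>The remaining series divided by the factor of its L-th term, so that
      \<open>h 0 = a L\<close>.\<close>
    define h where "h = (\<lambda>j. t powr (\<alpha> * real j) * (Gamma (real c + p) / Gamma (real c + p + \<alpha> * real j)) * a (j + L))"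
    have "(\<lambda>j. frac_monom (\<alpha> + real c + \<alpha> * real (j + L)) t * a (j + L)) sums 0"
      using zero[of c] less sums_iff_shift[of "\<lambda>l. frac_monom (\<alpha> + real c + \<alpha> * real l) t * a l" L 0] by simp
    then have "(\<lambda>j. (Gamma (real c + p) / t powr (real c + p - 1)) * (frac_monom (\<alpha> + real c + \<alpha> * real (j + L)) t * a (j + L))) sums
        ((Gamma (real c + p) / t powr (real c + p - 1)) * 0)"
      by (rule sums_mult)
    also have "(\<lambda>j. (Gamma (real c + p) / t powr (real c + p - 1)) * (frac_monom (\<alpha> + real c + \<alpha> * real (j + L)) t * a (j + L))) = h"
    proof
      fix j
      have e: "\<alpha> + real c + \<alpha> * real (j + L) = (real c + p - 1) + \<alpha> * real j"
        by (simp add: p_def algebra_simps)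
      show "(Gamma (real c + p) / t powr (real c + p - 1)) * (frac_monom (\<alpha> + real c + \<alpha> * real (j + L)) t * a (j + L)) = h j"
        unfolding e h_def using t by (simp add: frac_monom_eq powr_add add_ac)
    qed
    finally have "h sums 0" by simp
    then have "(\<lambda>j. h (Suc j)) sums (0 - h 0)"
      by (subst sums_Suc_iff) simp
    moreover have "h 0 = a L"
      using p t by (simp add: h_def)
    ultimately have "\<bar>a L\<bar> = \<bar>suminf (\<lambda>j. h (Suc j))\<bar>"
      by (simp add: sums_iff)
    also have "\<dots> = norm (suminf (\<lambda>j. h (Suc j)))"
      by simp
    also have "\<dots> \<le> suminf (\<lambda>j. Gamma (real c + p) / Gamma (real c + p + \<alpha>) * D j)"
    proof (rule norm_suminf_le)
      fix j
      define \<delta> where "\<delta> = \<alpha> * real (Suc j)"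
      have \<delta>: "\<alpha> \<le> \<delta>" using \<alpha> by (simp add: \<delta>_def)
      \<comment> \<open>The reciprocal rising factorial starting at p + \<delta> is replaced by the
        one starting at p + \<alpha>, which no longer involves j.\<close>
      have "Gamma (p + \<delta>) / Gamma (real c + (p + \<delta>)) \<le> Gamma (p + \<alpha>) / Gamma (real c + (p + \<alpha>))"
        using p \<alpha> \<delta> by (intro Gamma_shift_nat_antimono) auto
      then have "Gamma (real c + p) / Gamma (p + \<delta>) * (Gamma (p + \<delta>) / Gamma (real c + (p + \<delta>)))
           \<le> Gamma (real c + p) / Gamma (p + \<delta>) * (Gamma (p + \<alpha>) / Gamma (real c + (p + \<alpha>)))"
        using p \<alpha> \<delta> by (intro mult_left_mono) auto
      then have G: "Gamma (real c + p) / Gamma (real c + p + \<delta>) \<le> Gamma (real c + p) / Gamma (real c + p + \<alpha>) * (Gamma (p + \<alpha>) / Gamma (p + \<delta>))"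
        using p \<alpha> \<delta> by (simp add: add_ac mult_ac)
      have "\<bar>h (Suc j)\<bar> = t powr \<delta> * (Gamma (real c + p) / Gamma (real c + p + \<delta>)) * \<bar>a (Suc j + L)\<bar>"
      proof -
        have "h (Suc j) = t powr \<delta> * (Gamma (real c + p) / Gamma (real c + p + \<delta>)) * a (Suc j + L)"
          by (simp add: h_def \<delta>_def)
        moreover have "Gamma (real c + p) > 0" "Gamma (real c + p + \<delta>) > 0"
          using p \<alpha> \<delta> by auto
        ultimately show ?thesis by (simp only: abs_mult abs_divide abs_of_pos abs_of_nonneg powr_ge_zero)
      qed
      also have "\<dots> \<le> t powr \<delta> * (Gamma (real c + p) / Gamma (real c + p + \<alpha>) * (Gamma (p + \<alpha>) / Gamma (p + \<delta>))) * (C * M ^ (Suc j + L))"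
        using p \<alpha> \<delta> G bound[of "Suc j + L"] by (intro mult_mono) auto
      also have "t powr \<delta> = t powr \<alpha> * (t powr \<alpha>) ^ j"
        using t by (simp add: \<delta>_def powr_add powr_powr powr_realpow[symmetric] distrib_left)
      also have "p + \<delta> = \<alpha> * real j + (p + \<alpha>)"
        by (simp add: \<delta>_def algebra_simps)
      finally show "norm (h (Suc j)) \<le> Gamma (real c + p) / Gamma (real c + p + \<alpha>) * D j"
        by (simp add: D_def power_mult_distrib power_add mult_ac)
    qed (use \<open>summable D\<close> in \<open>intro summable_mult\<close>)
    also have "\<dots> = Gamma (real c + p) / Gamma (real c + p + \<alpha>) * suminf D"
      by (rule suminf_mult[OF \<open>summable D\<close>])
    finally show ?thesis .
  qed
  have "(\<lambda>c. Gamma (real c + p) / Gamma (real c + p + \<alpha>)) \<longlonglongrightarrow> 0"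
  proof (rule filterlim_compose[OF Gamma_shift_ratio_tendsto_0[OF \<alpha>]])
    show "LIM c sequentially. real c + p :> at_top" by real_asymp
  qed
  then have "(\<lambda>c. Gamma (real c + p) / Gamma (real c + p + \<alpha>) * suminf D) \<longlonglongrightarrow> 0 * suminf D"
    by (intro tendsto_intros)
  then have "\<bar>a L\<bar> \<le> 0 * suminf D"
    using le by (intro LIMSEQ_le_const) auto
  then show "a L = 0" by simp
qed

text \<open>Quantifying over all l, not just l < \<mu>, makes the space of annihilating v invariant
  under right multiplication by A and confines the minimal polynomial to a single
  equivalence.\<close>

definition kalman_condition :: "real^'n^'n \<Rightarrow> real^'m^'n \<Rightarrow> bool" where
  "kalman_condition A B \<longleftrightarrow> (\<forall>v. (\<forall>l. v v* (matpow A l ** B) = 0) \<longrightarrow> v = 0)"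

text \<open>By superposition it suffices to steer from zero initial data to \<open>xstar\<close>
  minus the final value of the uncontrolled motion \<open>x1\<close>.\<close>

lemma kalman_condition_imp_controllable:
  fixes A :: "real^'n^'n" and B :: "real^'m^'n"
  assumes \<alpha>: "\<alpha> > 0" and k: "0 < k" "real k - 1 < \<alpha>" "\<alpha> \<le> real k" and t: "t > 0"
    and obs: "kalman_condition A B"
  shows "caputo_controllable \<alpha> k A B t"
proof -
  \<comment> \<open>With all continuous controls allowed, instead of the span of the explicit
    states, membership in \<open>R\<close> directly supplies a control.\<close>
  define R where "R = {y. \<exists>u x. continuous_on {0..t} u \<and> chain_solution \<alpha> k A B t u (\<lambda>_. 0) x \<and> x t = y}"
  have reach: "mittag_leffler \<alpha> A (\<alpha> + real c) (B *v e) t \<in> R" for c e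
    unfolding R_def using chain_solution_control[OF \<alpha> k, where A=A and t=t and B=B and c=c and e=e]
    by (auto intro!: exI[of _ "\<lambda>s. frac_monom (real c) s *\<^sub>R e"] continuous_intros continuous_on_frac_monom)
  have "subspace R"
    unfolding subspace_def
  proof (intro conjI ballI allI)
    show "0 \<in> R"
      unfolding R_def using chain_solution_zero[OF k(3), of A B t] by (auto intro!: exI[of _ "\<lambda>_. 0"])
  next
    fix y y' assume "y \<in> R" "y' \<in> R"
    then show "y + y' \<in> R"
    proof -
      from \<open>y \<in> R\<close> obtain u x where u: "continuous_on {0..t} u" "chain_solution \<alpha> k A B t u (\<lambda>_. 0) x" "x t = y"
        by (auto simp: R_def)
      from \<open>y' \<in> R\<close> obtain u' x' where u': "continuous_on {0..t} u'" "chain_solution \<alpha> k A B t u' (\<lambda>_. 0) x'" "x' t = y'"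
        by (auto simp: R_def)
      from chain_solution_add[OF u(2) u'(2) k(3)] continuous_on_add[OF u(1) u'(1)] u(3) u'(3)
      show ?thesis unfolding R_def by auto
    qed
  next
    fix c y assume "y \<in> R"
    then show "c *\<^sub>R y \<in> R"
    proof -
      from \<open>y \<in> R\<close> obtain u x where u: "continuous_on {0..t} u" "chain_solution \<alpha> k A B t u (\<lambda>_. 0) x" "x t = y"
        by (auto simp: R_def)
      from chain_solution_scaleR[OF u(2), of c] continuous_on_scaleR[OF continuous_on_const[of _ c] u(1)] u(3)
      show ?thesis unfolding R_def by auto
    qed
  qed
  have "R = UNIV"
  proof (rule ccontr)
    assume "R \<noteq> UNIV"
    then have "span R \<noteq> UNIV" using \<open>subspace R\<close> by (metis span_eq_iff)
    then obtain v where v: "v \<noteq> 0" "\<And>y. y \<in> R \<Longrightarrow> v \<bullet> y = 0"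
      by (meson span_base span_not_UNIV_orthogonal)
    obtain M where M: "M > 0" "\<And>l v. norm (matpow A l *v v) \<le> M ^ l * norm v"
      using matpow_bound[of A] by blast
    \<comment> \<open>The coefficients v A^l B e are the same for every offset c, so one sequence
      satisfies infinitely many series identities.\<close>
    have *: "v \<bullet> (matpow A l *v (B *v e)) = 0" for l e
    proof (rule frac_monom_series_coeffs_zero[OF \<alpha> t, where a="\<lambda>l. v \<bullet> (matpow A l *v (B *v e))"])
      show "\<bar>v \<bullet> (matpow A l *v (B *v e))\<bar> \<le> (norm v * norm (B *v e)) * M ^ l" for l
      proof -
        have "\<bar>v \<bullet> (matpow A l *v (B *v e))\<bar> \<le> norm v * norm (matpow A l *v (B *v e))"
          by (rule Cauchy_Schwarz_ineq2)
        also have "\<dots> \<le> norm v * (M ^ l * norm (B *v e))"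
          using M by (intro mult_left_mono) auto
        finally show ?thesis by (simp add: mult_ac)
      qed
      show "(\<lambda>l. frac_monom (\<alpha> + real c + \<alpha> * real l) t * (v \<bullet> (matpow A l *v (B *v e)))) sums 0" for c
      proof -
        have "(\<lambda>l. v \<bullet> (frac_monom (\<alpha> + real c + \<alpha> * real l) t *\<^sub>R (matpow A l *v (B *v e)))) sums
            (v \<bullet> mittag_leffler \<alpha> A (\<alpha> + real c) (B *v e) t)"
          using \<alpha> t by (intro bounded_linear.sums[OF bounded_linear_inner_right] mittag_leffler_sums) auto
        then show ?thesis using v(2)[OF reach] by simp
      qed
    qed
    have "v v* (matpow A l ** B) = 0" for l
    proof -
      have "(v v* (matpow A l ** B)) \<bullet> e = 0" for e
        using *[of l e] by (simp add: dot_lmul_matrix matrix_vector_mul_assoc)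
      then show ?thesis using inner_eq_zero_iff by blast
    qed
    then show False using obs v(1) by (auto simp: kalman_condition_def)
  qed
  show ?thesis
    unfolding caputo_controllable_def
  proof (intro allI)
    fix x0 :: "nat \<Rightarrow> real^'n" and xstar :: "real^'n"
    define x1 where "x1 = (\<lambda>s. \<Sum>i<k. mittag_leffler \<alpha> A (real i) (x0 i) s)"
    have "chain_solution \<alpha> k A B t (\<lambda>s. \<Sum>i<k. 0) (\<lambda>j. \<Sum>i<k. if j = i then x0 i else 0) x1"
      unfolding x1_def using \<alpha> k by (intro chain_solution_sum chain_solution_initial) auto
    moreover have "(\<Sum>i<k. if j = i then x0 i else 0) = (if j < k then x0 j else 0)" for j
      by auto
    ultimately have x1: "chain_solution \<alpha> k A B t (\<lambda>s. 0) (\<lambda>j. if j < k then x0 j else 0) x1"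
      by simp
    obtain u x where ux: "continuous_on {0..t} u" "chain_solution \<alpha> k A B t u (\<lambda>_. 0) x" "x t = xstar - x1 t"
    proof -
      have "xstar - x1 t \<in> R" using \<open>R = UNIV\<close> by simp
      then show ?thesis unfolding R_def using that by blast
    qed
    have "chain_solution \<alpha> k A B t u (\<lambda>j. if j < k then x0 j else 0) (\<lambda>s. x1 s + x s)"
      using chain_solution_add[OF x1 ux(2) k(3)] by simp
    then have "caputo_solution \<alpha> k A B t u (\<lambda>j. if j < k then x0 j else 0) (\<lambda>s. x1 s + x s)"
      using t k by (intro chain_solution_imp_caputo_solution)
    \<comment> \<open>\<open>caputo_solution\<close> reads the initial data at indices below k,
      where the truncated sequence agrees with \<open>x0\<close>.\<close>
    then have "caputo_solution \<alpha> k A B t u x0 (\<lambda>s. x1 s + x s)"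
      by (simp add: caputo_solution_def)
    moreover have "admissible_control t u"
      unfolding admissible_control_def piecewise_continuous_on_def
      using ux(1) by (auto intro!: exI[of _ "{}"] compact_imp_bounded compact_continuous_image)
    ultimately show "\<exists>u. admissible_control t u \<and> (\<exists>x. caputo_solution \<alpha> k A B t u x0 x \<and> x t = xstar)"
      using ux(3) by (intro exI[of _ u] conjI exI[of _ "\<lambda>s. x1 s + x s"]) auto
  qed
qed

section \<open>Necessity of the Kalman condition\<close>

lemma frac_integral_0 [simp]: "frac_integral 0 f = f"
  by (simp add: frac_integral_def fun_eq_iff)

text \<open>By the semigroup law, order m + 1 is one ordinary integration after order m, so the
  fundamental theorem of calculus applies to a continuous integrand.\<close>

lemma frac_integral_Suc_has_vector_derivative:
  fixes f :: "real \<Rightarrow> 'a::euclidean_space"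
  assumes "continuous_on {0..t} f" "s \<in> {0..t}"
  shows "(frac_integral (real (Suc m)) f has_vector_derivative frac_integral (real m) f s) (at s within {0..t})"
proof -
  let ?g = "frac_integral (real m) f"
  have "continuous_on {0..t} ?g"
    using assms by (intro continuous_on_frac_integral) auto
  then have deriv: "((\<lambda>u. integral {0..u} ?g) has_vector_derivative ?g s) (at s within {0..t})"
    using assms(2) by (rule integral_has_vector_derivative)
  have "frac_integral (real (Suc m)) f u = integral {0..u} ?g" if "u \<in> {0..t}" for u
    using frac_integral_frac_integral[OF assms(1), of 1 "real m" u] that by (simp add: frac_integral_1)
  then show ?thesis
    by (rule has_vector_derivative_transform[OF assms(2) _ deriv])
qed

lemma deriv_chain_frac_integral:
  fixes f :: "real \<Rightarrow> 'a::euclidean_space"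
  assumes "continuous_on {0..t} f"
  shows "deriv_chain {0..t} r (\<lambda>j. frac_integral (real (r - j)) f)"
  unfolding deriv_chain_def
proof safe
  fix j s assume "j < r" "s \<in> {0..t}"
  then show "(frac_integral (real (r - j)) f has_vector_derivative frac_integral (real (r - Suc j)) f s) (at s within {0..t})"
    using frac_integral_Suc_has_vector_derivative[OF assms, of s "r - Suc j"] by (simp only: Suc_diff_Suc)
qed

lemma deriv_chain_nderiv:
  assumes "times_differentiable_on r f S"
  shows "deriv_chain S r (\<lambda>j. nderiv S j f)"
  unfolding deriv_chain_def
proof safe
  fix j s assume "j < r" "s \<in> S"
  then have "nderiv S j f differentiable (at s within S)"
    using assms by (auto simp: times_differentiable_on_def)
  then show "(nderiv S j f has_vector_derivative nderiv S (Suc j) f s) (at s within S)"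
    by (simp add: vector_derivative_works)
qed

text \<open>Taylor's formula with vanishing initial values: starting from the top derivative, each
  induction step integrates once and the boundary term is 0.\<close>

lemma deriv_chain_eq_frac_integral:
  fixes D :: "nat \<Rightarrow> real \<Rightarrow> 'a::euclidean_space"
  assumes "deriv_chain {0..t} r D" "continuous_on {0..t} (D r)" "\<And>j. j < r \<Longrightarrow> D j 0 = 0"
    and "i \<le> r" "s \<in> {0..t}"
  shows "D (r - i) s = frac_integral (real i) (D r) s"
  using assms(4,5)
proof (induction i arbitrary: s)
  case 0
  then show ?case by (simp add: frac_integral_def)
next
  case (Suc i)
  define j where "j = r - Suc i"
  have j: "j < r" "Suc j = r - i" using Suc.prems by (auto simp: j_def)
  have "(D (Suc j) has_integral D j s - D j 0) {0..s}"
  proof (rule fundamental_theorem_of_calculus)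
    show "(D j has_vector_derivative D (Suc j) x) (at x within {0..s})" if "x \<in> {0..s}" for x
      using assms(1) j that Suc.prems unfolding deriv_chain_def
      by (auto intro!: has_vector_derivative_within_subset[of _ _ _ "{0..t}" "{0..s}"])
  qed (use Suc.prems in auto)
  then have "D j s = integral {0..s} (D (Suc j))"
    using assms(3)[OF j(1)] by (simp add: integral_unique)
  also have "\<dots> = frac_integral 1 (D (Suc j)) s"
    using Suc.prems by (simp add: frac_integral_1)
  also have "\<dots> = frac_integral 1 (frac_integral (real i) (D r)) s"
    using Suc by (intro frac_integral_cong) (auto simp: j(2))
  also have "\<dots> = frac_integral (real (Suc i)) (D r) s"
    using frac_integral_frac_integral[OF assms(2), of 1 "real i" s] Suc.prems by simp
  finally show ?case by (simp add: j_def)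
qed

text \<open>The zero function acquires two derivative chains, one of them ending in
  \<open>f\<close>, and iterated derivatives are unique.\<close>

lemma frac_integral_nat_eq_0:
  fixes f :: "real \<Rightarrow> 'a::euclidean_space"
  assumes "continuous_on {0..t} f" "t > 0" "s \<in> {0..t}"
    and "\<And>s. s \<in> {0..t} \<Longrightarrow> frac_integral (real m) f s = 0"
  shows "f s = 0"
proof -
  have "nderiv {0..t} m (\<lambda>_. 0 :: 'a) s = f s"
    using nderiv_deriv_chain[OF deriv_chain_frac_integral[OF assms(1), of m] assms(2), of "\<lambda>_. 0" m s] assms
    by (simp add: frac_integral_def)
  moreover have "nderiv {0..t} m (\<lambda>_. 0 :: 'a) s = 0"
    using nderiv_deriv_chain[of t m "\<lambda>_ _. 0 :: 'a" "\<lambda>_. 0" m s] assms by (simp add: deriv_chain_def)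
  ultimately show ?thesis by simp
qed

text \<open>Iterating the relation \<open>N\<close> times gains a factor \<open>M\<^sup>N s\<^sup>\<alpha>\<^sup>N / \<Gamma>(\<alpha>N + 1)\<close>, which tends to \<open>0\<close>.\<close>

lemma frac_integral_hierarchy_eq_0:
  fixes Z :: "nat \<Rightarrow> real \<Rightarrow> real"
  assumes \<alpha>: "\<alpha> > 0" and cont: "\<And>l. continuous_on {0..t} (Z l)"
    and rec: "\<And>l s. s \<in> {0..t} \<Longrightarrow> Z l s = frac_integral \<alpha> (Z (Suc l)) s"
    and bound: "\<And>l s. s \<in> {0..t} \<Longrightarrow> \<bar>Z l s\<bar> \<le> K * M ^ l" and s: "s \<in> {0..t}"
  shows "Z 0 s = 0"
proof -
  have *: "\<bar>Z l s\<bar> \<le> frac_monom (\<alpha> * real N) s * (K * M ^ (l + N))" if "s \<in> {0..t}" for l N s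
    using that
  proof (induction N arbitrary: l s)
    case 0
    then show ?case using bound by (simp add: frac_monom_def)
  next
    case (Suc N)
    have "\<bar>Z l s\<bar> = norm (frac_integral \<alpha> (Z (Suc l)) s)"
      using rec Suc.prems by simp
    also have "\<dots> \<le> frac_integral \<alpha> (\<lambda>\<tau>. frac_monom (\<alpha> * real N) \<tau> *\<^sub>R (K * M ^ (Suc l + N))) s"
    proof (rule frac_integral_norm_bound[where t=t])
      show "norm (Z (Suc l) \<tau>) \<le> frac_monom (\<alpha> * real N) \<tau> *\<^sub>R (K * M ^ (Suc l + N))" if "\<tau> \<in> {0..s}" for \<tau>
        using Suc.IH[of \<tau> "Suc l"] Suc.prems that by simp
    qed (use \<alpha> cont Suc.prems in \<open>auto intro!: continuous_intros continuous_on_frac_monom\<close>)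
    also have "\<dots> = frac_monom (\<alpha> * real N + \<alpha>) s *\<^sub>R (K * M ^ (Suc l + N))"
      using \<alpha> Suc.prems by (intro frac_integral_frac_monom) auto
    finally show ?case by (simp add: algebra_simps)
  qed
  have "(\<lambda>N. M ^ N * frac_monom (0 + \<alpha> * real N) s) \<longlonglongrightarrow> 0"
    using \<alpha> s by (intro summable_LIMSEQ_zero summable_frac_monom) auto
  then have "(\<lambda>N. K * (M ^ N * frac_monom (0 + \<alpha> * real N) s)) \<longlonglongrightarrow> K * 0"
    by (intro tendsto_intros)
  moreover have "\<bar>Z 0 s\<bar> \<le> K * (M ^ N * frac_monom (0 + \<alpha> * real N) s)" for N
    using *[OF s, of 0 N] by (simp add: mult_ac)
  ultimately have "\<bar>Z 0 s\<bar> \<le> K * 0"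
    by (intro LIMSEQ_le_const) auto
  then show ?thesis by simp
qed

lemma vector_matpow_mult:
  "(v v* matpow A l) v* A = v v* matpow A (Suc l)"
  by (simp add: vector_matrix_mul_assoc matpow_commute)

text \<open>With \<open>g\<close> the (k - 1)-th derivative of \<open>x\<close> and \<open>h\<close>
  its integral of order \<beta>, \<open>x\<close> and its integral of order \<beta> are the (k -
  1)-fold integrals of \<open>g\<close> and \<open>h\<close>. The Caputo condition thus says that
  \<open>h\<close> has derivative A x + B u away from the jumps.\<close>

lemma caputo_solution_zero_initial_orthogonal:
  fixes A :: "real^'n^'n" and B :: "real^'m^'n"
  assumes \<alpha>: "\<alpha> > 0" and k: "0 < k" "\<alpha> \<le> real k" "real k - 1 < \<alpha>" and t: "t > 0"
    and v: "\<And>l. v v* (matpow A l ** B) = 0"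
    and u: "admissible_control t u" and sol: "caputo_solution \<alpha> k A B t u (\<lambda>_. 0) x"
  shows "v \<bullet> x t = 0"
proof -
  define \<beta> where "\<beta> = real k - \<alpha>"
  have \<beta>: "\<beta> \<ge> 0" using k by (simp add: \<beta>_def)
  define g where "g = nderiv {0..t} (k - 1) x"
  define h where "h = frac_integral \<beta> g"
  have g: "continuous_on {0..t} g" "deriv_chain {0..t} (k - 1) (\<lambda>j. nderiv {0..t} j x)"
    and ic: "\<And>j. j < k \<Longrightarrow> nderiv {0..t} j x 0 = 0"
    using sol by (auto simp: caputo_solution_def Ck_on_def g_def intro: deriv_chain_nderiv)
  have x_eq: "x s = frac_integral (real (k - 1)) g s" if "s \<in> {0..t}" for s
    using deriv_chain_eq_frac_integral[OF g(2), of "k - 1" s] g(1) ic that k by (auto simp: g_def)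
  have x: "continuous_on {0..t} x"
    by (rule continuous_on_eq[OF continuous_on_frac_integral[OF g(1), of "real (k - 1)"]]) (use x_eq in auto)
  have h: "continuous_on {0..t} h"
    unfolding h_def using g \<beta> by (intro continuous_on_frac_integral)
  have y_eq: "frac_integral \<beta> x s = frac_integral (real (k - 1 - 0)) h s" if "s \<in> {0..t}" for s
  proof -
    have "frac_integral \<beta> x s = frac_integral \<beta> (frac_integral (real (k - 1)) g) s"
      using that x_eq by (intro frac_integral_cong) auto
    also have "\<dots> = frac_integral (real (k - 1)) (frac_integral \<beta> g) s"
      using that g(1) \<beta> by (simp add: frac_integral_frac_integral[of t] add.commute)
    finally show ?thesis by (simp add: h_def)
  qed
  have nd: "nderiv {0..t} (k - 1) (frac_integral \<beta> x) s = h s" if "s \<in> {0..t}" for s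
    using nderiv_deriv_chain[OF deriv_chain_frac_integral[OF h, of "k - 1"] t y_eq, of "k - 1" s] that
    by simp
  \<comment> \<open>For \<beta> > 0 this is an integral over a single point; for \<beta> = 0, that
    is \<alpha> = k, \<open>h\<close> equals \<open>g\<close> and the initial condition of order k -
    1 is used.\<close>
  have h0: "h 0 = 0"
  proof (cases "\<beta> = 0")
    case True
    then show ?thesis
      using ic[of "k - 1"] k by (simp add: h_def g_def)
  qed (simp add: h_def frac_integral_def)
  obtain F where F: "finite F" "F \<subseteq> {0..t}" "continuous_on ({0..t} - F) u"
    using u unfolding admissible_control_def piecewise_continuous_on_def by blast
  have dh: "(h has_vector_derivative A *v x \<tau> + B *v u \<tau>) (at \<tau>)" if \<tau>: "\<tau> \<in> {0<..<t} - F" for \<tau>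
  proof -
    have "\<tau> \<in> {0..t} - F" "\<tau> \<in> {0..t}" using \<tau> by auto
    then have "continuous (at \<tau> within ({0..t} - F)) u"
      using F(3) by (auto simp: continuous_on_eq_continuous_within)
    \<comment> \<open>\<open>F\<close> is finite, hence closed, so \<open>{0..t} - F\<close> and
      \<open>{0..t}\<close> coincide near \<tau>; continuity relative to the first set gives the one
      that \<open>caputo_solution\<close> asks for.\<close>
    moreover have "at \<tau> within ({0..t} - F) = at \<tau> within {0..t}"
    proof (rule at_within_nhd[of _ "- F"])
      show "open (- F)" using finite_imp_closed[OF F(1)] by auto
    qed (use \<tau> in auto)
    ultimately have "continuous (at \<tau> within {0..t}) u"
      by (simp add: continuous_within)
    then have "has_caputo_derivative \<alpha> k t x (A *v x \<tau> + B *v u \<tau>) \<tau>"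
      using sol \<open>\<tau> \<in> {0..t}\<close> by (auto simp: caputo_solution_def)
    moreover have "(\<lambda>s. x s - (\<Sum>j<k. (s ^ j / fact j) *\<^sub>R nderiv {0..t} j x 0)) = x"
      using ic by auto
    ultimately have "(nderiv {0..t} (k - 1) (frac_integral \<beta> x) has_vector_derivative A *v x \<tau> + B *v u \<tau>) (at \<tau> within {0..t})"
      by (simp add: has_caputo_derivative_def Let_def \<beta>_def)
    then have "(h has_vector_derivative A *v x \<tau> + B *v u \<tau>) (at \<tau> within {0..t})"
      by (rule has_vector_derivative_transform[rotated 2]) (use \<tau> nd in auto)
    then show ?thesis
      using \<tau> by (simp add: at_within_Icc_at)
  qed
  define w where "w = (\<lambda>l. v v* matpow A l)"
  define z where "z = (\<lambda>l s. x s \<bullet> w l)"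
  have z: "continuous_on {0..t} (z l)" for l
    unfolding z_def using x by (intro continuous_intros)
  have gw: "continuous_on {0..t} (\<lambda>\<tau>. g \<tau> \<bullet> w l)" for l
    using g by (intro continuous_intros)
  \<comment> \<open>The fundamental theorem tolerates the finitely many points of \<open>F\<close>
    because \<open>h\<close> is continuous. The control drops out through
    \<open>w l v* B = 0\<close>, and A turns \<open>w l\<close> into
    \<open>w (Suc l)\<close>.\<close>
  have step: "frac_integral \<beta> (\<lambda>\<tau>. g \<tau> \<bullet> w l) s = frac_integral 1 (z (Suc l)) s" if s: "s \<in> {0..t}" for l s
  proof -
    have "(z (Suc l) has_integral h s \<bullet> w l - h 0 \<bullet> w l) {0..s}"
    proof (rule fundamental_theorem_of_calculus_interior_strong[OF F(1)])
      fix \<tau> assume \<tau>: "\<tau> \<in> {0<..<s} - F"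
      then have "((\<lambda>\<tau>. h \<tau> \<bullet> w l) has_vector_derivative (A *v x \<tau> + B *v u \<tau>) \<bullet> w l) (at \<tau>)"
        using s bounded_linear.has_vector_derivative[OF bounded_linear_inner_left dh, of \<tau> "w l"] by simp
      also have "(A *v x \<tau> + B *v u \<tau>) \<bullet> w l = (w l v* A) \<bullet> x \<tau> + (w l v* B) \<bullet> u \<tau>"
        by (simp add: dot_lmul_matrix inner_add_left inner_commute[of "w l"])
      also have "w l v* B = 0"
        using v[of l] by (simp add: w_def vector_matrix_mul_assoc)
      also have "w l v* A = w (Suc l)"
        unfolding w_def by (rule vector_matpow_mult)
      finally show "((\<lambda>\<tau>. h \<tau> \<bullet> w l) has_vector_derivative z (Suc l) \<tau>) (at \<tau>)"
        by (simp add: z_def inner_commute)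
    qed (use s h in \<open>auto intro!: continuous_intros elim: continuous_on_subset\<close>)
    then have "h s \<bullet> w l = frac_integral 1 (z (Suc l)) s"
      using s h0 by (simp add: frac_integral_1 integral_unique)
    then show ?thesis
      using frac_integral_inner[OF g(1) s \<beta>] by (simp add: h_def)
  qed
  have z_eq: "z l s = frac_integral (real (k - 1)) (\<lambda>\<tau>. g \<tau> \<bullet> w l) s" if "s \<in> {0..t}" for l s
    using that frac_integral_inner[OF g(1) that] by (simp add: z_def x_eq)
  have Iz: "frac_integral \<beta> (z l) s = frac_integral (real k) (z (Suc l)) s" if s: "s \<in> {0..t}" for l s
  proof -
    have "frac_integral \<beta> (z l) s = frac_integral \<beta> (frac_integral (real (k - 1)) (\<lambda>\<tau>. g \<tau> \<bullet> w l)) s"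
      using s z_eq by (intro frac_integral_cong) auto
    also have "\<dots> = frac_integral (real (k - 1)) (frac_integral \<beta> (\<lambda>\<tau>. g \<tau> \<bullet> w l)) s"
      using s gw \<beta> by (simp add: frac_integral_frac_integral[of t] add.commute)
    also have "\<dots> = frac_integral (real (k - 1)) (frac_integral 1 (z (Suc l))) s"
      using s step by (intro frac_integral_cong) auto
    also have "\<dots> = frac_integral (real k) (z (Suc l)) s"
      using s z k by (simp add: frac_integral_frac_integral[of t])
    finally show ?thesis .
  qed
  \<comment> \<open>Since \<alpha> + \<beta> = k, integrating \<open>Iz\<close> to order \<alpha>
    gives a recursion for the functions \<open>frac_integral (real k) (z l)\<close>.\<close>
  have "frac_integral (real k) (z 0) s = 0" if s: "s \<in> {0..t}" for s
  proof -
    obtain M where M: "M > 0" "\<And>l v. norm (matpow A l *v v) \<le> M ^ l * norm v"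
      using matpow_bound[of A] by blast
    have "bounded (x ` {0..t})"
      using x by (intro compact_imp_bounded compact_continuous_image) auto
    then obtain C where "\<forall>y \<in> x ` {0..t}. norm y \<le> C"
      unfolding bounded_iff by blast
    then have C: "norm (x s) \<le> C" if "s \<in> {0..t}" for s
      using that by blast
    have zb: "norm (z l s) \<le> norm v * C * M ^ l" if "s \<in> {0..t}" for l s
    proof -
      have "norm (z l s) = \<bar>v \<bullet> (matpow A l *v x s)\<bar>"
        by (simp add: z_def w_def inner_commute[of "x s"] dot_lmul_matrix)
      also have "\<dots> \<le> norm v * norm (matpow A l *v x s)"
        by (rule Cauchy_Schwarz_ineq2)
      also have "\<dots> \<le> norm v * (M ^ l * C)"
        using M(1) by (intro mult_left_mono order_trans[OF M(2)] C that) auto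
      finally show ?thesis by (simp add: mult_ac)
    qed
    show ?thesis
    proof (rule frac_integral_hierarchy_eq_0[OF \<alpha>, where Z="\<lambda>l. frac_integral (real k) (z l)" and t=t])
      show "continuous_on {0..t} (frac_integral (real k) (z l))" for l
        using z by (intro continuous_on_frac_integral) auto
      show "frac_integral (real k) (z l) s = frac_integral \<alpha> (frac_integral (real k) (z (Suc l))) s"
        if "s \<in> {0..t}" for l s
      proof -
        have "frac_integral (real k) (z l) s = frac_integral \<alpha> (frac_integral \<beta> (z l)) s"
          using that z \<alpha> \<beta> by (simp add: frac_integral_frac_integral[of t] \<beta>_def)
        also have "\<dots> = frac_integral \<alpha> (frac_integral (real k) (z (Suc l))) s"
          using that Iz by (intro frac_integral_cong) auto
        finally show ?thesis .
      qed
      show "\<bar>frac_integral (real k) (z l) s\<bar> \<le> norm v * C * frac_monom (real k) t * M ^ l" if "s \<in> {0..t}" for l s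
        using frac_integral_norm_bound_const[OF z that, of "real k" l "norm v * C * M ^ l"] zb that by (simp add: mult_ac)
    qed (rule s)
  qed
  then have "z 0 t = 0"
    using t by (intro frac_integral_nat_eq_0[OF z t, of t k]) auto
  then show ?thesis
    by (simp add: z_def w_def inner_commute)
qed

lemma controllable_imp_kalman_condition:
  fixes A :: "real^'n^'n" and B :: "real^'m^'n"
  assumes "\<alpha> > 0" "0 < k" "\<alpha> \<le> real k" "real k - 1 < \<alpha>" "t > 0"
    and ctrl: "caputo_controllable \<alpha> k A B t"
  shows "kalman_condition A B"
  unfolding kalman_condition_def
proof (intro allI impI)
  fix v assume v: "\<forall>l. v v* (matpow A l ** B) = 0"
  obtain u x where "admissible_control t u" "caputo_solution \<alpha> k A B t u (\<lambda>_. 0) x" "x t = v"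
    using ctrl unfolding caputo_controllable_def by blast
  then have "v \<bullet> v = 0"
    using caputo_solution_zero_initial_orthogonal[OF assms(1-5)] v by blast
  then show "v = 0" by simp
qed

section \<open>Rank conditions\<close>

lemma vector_matrix_nth: "(v v* M) $ j = (\<Sum>i\<in>UNIV. v $ i * M $ i $ j)"
  for v :: "'a::comm_semiring_1^'n"
  by (simp add: vector_matrix_mult_def mult.commute)

lemma matpow_add: "matpow A (a + b) = matpow A a ** matpow A b"
  by (induction a) (auto simp: matrix_mul_assoc)

section \<open>Polynomials in a matrix and the minimal polynomial\<close>

lemma poly_matrix_eq_sum:
  assumes "degree p \<le> N"
  shows "poly_matrix p A = (\<Sum>i\<le>N. coeff p i *\<^sub>R matpow A i)"
  unfolding poly_matrix_def using assms
  by (intro sum.mono_neutral_left) (auto simp: coeff_eq_0)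

lemma poly_matrix_diff: "poly_matrix (p - q) A = poly_matrix p A - poly_matrix q A"
proof -
  define N where "N = max (degree p) (degree q)"
  have "degree (p - q) \<le> N" "degree p \<le> N" "degree q \<le> N"
    using degree_diff_le_max[of p q] by (auto simp: N_def)
  then show ?thesis
    by (simp add: poly_matrix_eq_sum[of _ N] scaleR_diff_left sum_subtractf)
qed

lemma poly_matrix_smult: "poly_matrix (smult c p) A = c *\<^sub>R poly_matrix p A"
  by (simp add: poly_matrix_eq_sum[of _ "degree p"] degree_smult_le scaleR_sum_right)

lemma linear_matrix_mult_left: "linear (\<lambda>X :: real^'n^'p. X ** (N :: real^'m^'n))"
  by (intro linearI)
     (simp_all add: vec_eq_iff matrix_matrix_mult_def distrib_right sum.distrib sum_distrib_left mult.assoc)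

lemma poly_matrix_pCons: "poly_matrix (pCons c p) A = c *\<^sub>R mat 1 + poly_matrix p A ** A"
proof -
  have "poly_matrix (pCons c p) A = (\<Sum>i\<le>Suc (degree p). coeff (pCons c p) i *\<^sub>R matpow A i)"
    by (intro poly_matrix_eq_sum) (simp add: degree_pCons_le)
  also have "\<dots> = c *\<^sub>R mat 1 + (\<Sum>i\<le>degree p. (coeff p i *\<^sub>R matpow A i) ** A)"
    by (subst sum.atMost_Suc_shift) (simp add: matpow_commute scalar_matrix_assoc)
  also have "(\<Sum>i\<le>degree p. (coeff p i *\<^sub>R matpow A i) ** A) = poly_matrix p A ** A"
    unfolding poly_matrix_def by (rule linear_sum[OF linear_matrix_mult_left, symmetric])
  finally show ?thesis .
qed

text \<open>Any n^2 + 1 distinct powers are linearly dependent in the n^2-dimensional matrix space.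
  Dependence is a property of sets, so a coincidence of two powers is treated apart and yields x^i -
  x^j.\<close>

lemma annihilating_poly_exists:
  fixes A :: "real^'n^'n"
  obtains p where "p \<noteq> 0" "poly_matrix p A = 0"
proof (cases "inj (matpow A)")
  case False
  then obtain i j where ij: "i \<noteq> j" "matpow A i = matpow A j"
    by (auto simp: inj_def)
  define p where "p = monom (1::real) i - monom 1 j"
  have "coeff p i = 1" using ij(1) by (simp add: p_def)
  then have "p \<noteq> 0" by auto
  have m: "poly_matrix (monom 1 i) A = matpow A i" for i
    by (simp add: poly_matrix_def degree_monom_eq sum.delta' if_distrib[of "\<lambda>c. c *\<^sub>R _"] cong: if_cong)
  then have "poly_matrix p A = 0"
    using ij(2) by (simp add: p_def poly_matrix_diff)
  then show ?thesis using \<open>p \<noteq> 0\<close> by (intro that)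
next
  case True
  let ?d = "DIM(real^'n^'n)"
  let ?S = "matpow A ` {..?d}"
  have inj: "inj_on (matpow A) {..?d}" using True by (auto intro: inj_on_subset)
  then have "card ?S = Suc ?d" by (simp add: card_image)
  then have "dependent ?S" by (intro dependent_biggerset) simp
  then obtain u where u: "\<exists>v\<in>?S. u v \<noteq> 0" "(\<Sum>v\<in>?S. u v *\<^sub>R v) = 0"
    by (auto simp: real_vector.dependent_finite)
  define p where "p = (\<Sum>i\<le>?d. monom (u (matpow A i)) i)"
  have coeff: "coeff p i = (if i \<le> ?d then u (matpow A i) else 0)" for i
    by (simp add: p_def coeff_sum)
  have "degree p \<le> ?d"
    using coeff by (intro degree_le) auto
  then have "poly_matrix p A = (\<Sum>i\<le>?d. u (matpow A i) *\<^sub>R matpow A i)"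
    by (simp add: poly_matrix_eq_sum coeff)
  also have "\<dots> = 0"
    using u(2) inj by (simp add: sum.reindex)
  finally have "poly_matrix p A = 0" .
  moreover have "p \<noteq> 0"
    using u(1) coeff by (metis atMost_iff coeff_0 image_iff)
  ultimately show ?thesis using that by blast
qed

text \<open>The description under \<open>THE\<close> must have exactly one solution: an annihilator
  of least degree can be made monic, and two such cannot differ, as their difference would
  annihilate A with smaller degree.\<close>

lemma min_poly_annihilates:
  "poly_matrix (min_poly A) A = 0" "lead_coeff (min_poly A) = 1"
proof -
  let ?P = "\<lambda>p. lead_coeff p = 1 \<and> poly_matrix p A = 0 \<and> (\<forall>q. q \<noteq> 0 \<longrightarrow> poly_matrix q A = 0 \<longrightarrow> degree p \<le> degree q)"
  have "\<exists>!p. ?P p"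
  proof (rule ex_ex1I)
    obtain p0 where "p0 \<noteq> 0 \<and> poly_matrix p0 A = 0"
      using annihilating_poly_exists by blast
    then obtain p where p: "p \<noteq> 0" "poly_matrix p A = 0"
        "\<And>q. q \<noteq> 0 \<Longrightarrow> poly_matrix q A = 0 \<Longrightarrow> degree p \<le> degree q"
      using ex_has_least_nat[of "\<lambda>p. p \<noteq> 0 \<and> poly_matrix p A = 0" p0 degree] by blast
    then show "\<exists>p. ?P p"
      by (intro exI[of _ "smult (inverse (lead_coeff p)) p"]) (auto simp: poly_matrix_smult)
  next
    fix p q assume p: "?P p" and q: "?P q"
    show "p = q"
    proof (rule ccontr)
      assume "p \<noteq> q"
      then have nz: "p - q \<noteq> 0" by simp
      have "p \<noteq> 0" "q \<noteq> 0" using p q by auto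
      then have d: "degree p = degree q" using p q by (meson le_antisym)
      have "degree p \<le> degree (p - q)"
        using p q nz by (auto simp: poly_matrix_diff)
      moreover have "degree (p - q) \<le> degree p"
        using degree_diff_le_max[of p q] d by simp
      ultimately have "degree (p - q) = degree p" by simp
      moreover have "coeff (p - q) (degree p) = 0"
        using p q d by simp
      ultimately show False using nz leading_coeff_0_iff by metis
    qed
  qed
  then have "?P (min_poly A)"
    unfolding min_poly_def by (rule theI')
  then show "poly_matrix (min_poly A) A = 0" "lead_coeff (min_poly A) = 1" by auto
qed

section \<open>Full rank as the absence of nonzero left annihilators\<close>

lemma vector_mult_eq_0_iff_columns:
  fixes M :: "real^'m^'n"
  shows "v v* M = 0 \<longleftrightarrow> (\<forall>c\<in>columns M. v \<bullet> c = 0)"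
proof -
  have "(v v* M) $ j = v \<bullet> column j M" for j
    by (simp add: vector_matrix_nth column_def inner_vec_def)
  then show ?thesis
    unfolding columns_def vec_eq_iff[of "v v* M"] by auto
qed

text \<open>The columns span the whole space exactly when no nonzero vector is orthogonal to all of
  them.\<close>

lemma block_row_rank_eq_iff:
  fixes M :: "nat \<Rightarrow> real^'m^'n"
  shows "block_row_rank M r = CARD('n) \<longleftrightarrow> (\<forall>v. (\<forall>i<r. v v* M i = 0) \<longrightarrow> v = 0)"
proof -
  let ?S = "\<Union>i<r. columns (M i)"
  have orth: "(\<forall>i<r. v v* M i = 0) \<longleftrightarrow> (\<forall>c\<in>?S. v \<bullet> c = 0)" for v
    unfolding vector_mult_eq_0_iff_columns by blast
  have "block_row_rank M r = CARD('n) \<longleftrightarrow> span ?S = UNIV"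
    unfolding block_row_rank_def using dim_eq_full[of ?S] by simp
  also have "\<dots> \<longleftrightarrow> (\<forall>v. (\<forall>c\<in>?S. v \<bullet> c = 0) \<longrightarrow> v = 0)"
  proof
    assume sp: "span ?S = UNIV"
    show "\<forall>v. (\<forall>c\<in>?S. v \<bullet> c = 0) \<longrightarrow> v = 0"
    proof (intro allI impI)
      fix v assume v: "\<forall>c\<in>?S. v \<bullet> c = 0"
      have "orthogonal v v"
      proof (rule orthogonal_to_span)
        show "v \<in> span ?S" using sp by simp
        show "orthogonal v c" if "c \<in> ?S" for c using bspec[OF v that] by (simp only: orthogonal_def)
      qed
      then show "v = 0" by (simp add: orthogonal_def)
    qed
  next
    assume *: "\<forall>v. (\<forall>c\<in>?S. v \<bullet> c = 0) \<longrightarrow> v = 0"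
    show "span ?S = UNIV"
      using span_not_UNIV_orthogonal[of ?S] * span_base by metis
  qed
  finally show ?thesis by (simp add: orth)
qed

text \<open>The minimal polynomial expresses A^(\<mu> + j) B through the blocks A^(i + j) B with i <
  \<mu>, so by strong induction a vector annihilating the first \<mu> blocks annihilates all of
  them.\<close>

lemma kalman_condition_iff_block_row_rank:
  fixes A :: "real^'n^'n" and B :: "real^'m^'n"
  shows "block_row_rank (\<lambda>i. matpow A i ** B) (degree (min_poly A)) = CARD('n) \<longleftrightarrow> kalman_condition A B"
proof -
  define p where "p = min_poly A"
  define \<mu> where "\<mu> = degree p"
  have "v v* (matpow A l ** B) = 0" if v: "\<forall>i<\<mu>. v v* (matpow A i ** B) = 0" for v l
  proof (induction l rule: less_induct)
    case (less l)
    show ?case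
    proof (cases "l < \<mu>")
      case False
      then obtain j where l: "l = \<mu> + j" using le_Suc_ex not_less by blast
      have "(\<Sum>i\<le>\<mu>. coeff p i *\<^sub>R matpow A i) = 0"
        using min_poly_annihilates(1)[of A] by (simp add: poly_matrix_def p_def \<mu>_def)
      moreover have "coeff p \<mu> = 1"
        using min_poly_annihilates(2)[of A] by (simp add: p_def \<mu>_def)
      ultimately have "matpow A \<mu> = - (\<Sum>i<\<mu>. coeff p i *\<^sub>R matpow A i)"
        by (simp add: lessThan_Suc_atMost[symmetric] eq_neg_iff_add_eq_0 add.commute)
      then have "v v* (matpow A \<mu> ** (matpow A j ** B)) = v v* ((- (\<Sum>i<\<mu>. coeff p i *\<^sub>R matpow A i)) ** (matpow A j ** B))"
        by simp
      also have "\<dots> = - (\<Sum>i<\<mu>. coeff p i *\<^sub>R (v v* (matpow A (i + j) ** B)))"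
      proof -
        have lin: "linear (\<lambda>X :: real^'n^'n. v v* (X ** (matpow A j ** B)))"
          by (simp add: linear_iff linear_add[OF linear_matrix_mult_left] linear_cmul[OF linear_matrix_mult_left]
              vector_matrix_mult_add_rdistrib vector_scaleR_matrix_ac)
        show ?thesis
          by (simp only: linear_neg[OF lin] linear_sum[OF lin] linear_cmul[OF lin] matpow_add matrix_mul_assoc[symmetric])
      qed
      also have "\<dots> = 0"
        using less l by simp
      finally show ?thesis
        by (simp add: l matpow_add matrix_mul_assoc)
    qed (use v in auto)
  qed
  then show ?thesis
    unfolding block_row_rank_eq_iff kalman_condition_def p_def \<mu>_def by blast
qed

lemma vector_mult_eq_sum_rows:
  fixes M :: "'a::field^'m^'n"
  shows "w v* M = (\<Sum>i\<in>UNIV. w $ i *s row i M)"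
  by (simp add: vec_eq_iff vector_matrix_nth row_def)

text \<open>Over a general field no orthogonality is available, so the rows are examined directly. A
  nonzero w with w M = 0 expresses one row through the others, leaving at most n - 1 spanning
  vectors; if only w = 0 is possible, the rows are distinct and independent.\<close>

lemma rank_eq_rows_iff:
  fixes M :: "'a::field^'m^'n"
  shows "rank M = CARD('n) \<longleftrightarrow> (\<forall>w. w v* M = 0 \<longrightarrow> w = 0)"
proof
  assume rank: "rank M = CARD('n)"
  show "\<forall>w. w v* M = 0 \<longrightarrow> w = 0"
  proof (intro allI impI, rule ccontr)
    fix w :: "'a^'n" assume w: "w v* M = 0" "w \<noteq> 0"
    then obtain j where j: "w $ j \<noteq> 0" by (auto simp: vec_eq_iff)
    let ?R = "(\<lambda>i. row i M) ` (UNIV - {j})"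
    have "w $ j *s row j M + (\<Sum>i\<in>UNIV - {j}. w $ i *s row i M) = 0"
      using w(1) unfolding vector_mult_eq_sum_rows by (subst (asm) sum.remove[of _ j]) auto
    then have "w $ j *s row j M = - (\<Sum>i\<in>UNIV - {j}. w $ i *s row i M)"
      by (simp add: eq_neg_iff_add_eq_0)
    also have "\<dots> \<in> vec.span ?R"
      by (intro vec.span_neg vec.span_sum vec.span_scale vec.span_base) auto
    finally have "inverse (w $ j) *s (w $ j *s row j M) \<in> vec.span ?R"
      by (rule vec.span_scale)
    then have "row j M \<in> vec.span ?R"
      using j by simp
    moreover have "row i M \<in> vec.span ?R" if "i \<noteq> j" for i
      using that by (intro vec.span_base) auto
    ultimately have "row i M \<in> vec.span ?R" for i
      by (cases "i = j") auto
    then have "rows M \<subseteq> vec.span ?R"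
      by (auto simp: rows_def)
    then have "rank M \<le> card ?R"
      unfolding row_rank_def_gen by (intro vec.dim_le_card) auto
    also have "\<dots> \<le> card (UNIV - {j})"
      by (intro card_image_le) auto
    also have "\<dots> < CARD('n)"
      by (intro psubset_card_mono) auto
    finally show False using rank by simp
  qed
next
  assume *: "\<forall>w. w v* M = 0 \<longrightarrow> w = 0"
  have rows: "rows M = range (\<lambda>i. row i M)" by (auto simp: rows_def)
  \<comment> \<open>\<open>rows M\<close> is a set, in which equal rows would be counted once; they
    are excluded first, by the relation e_i - e_j.\<close>
  have inj: "inj (\<lambda>i. row i M)"
  proof (rule injI, rule ccontr)
    fix i j assume ij: "row i M = row j M" "i \<noteq> j"
    define w :: "'a^'n" where "w = axis i 1 - axis j 1"
    have "w v* M = row i M - row j M"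
      by (simp add: w_def vec_eq_iff vector_matrix_nth row_def axis_def left_diff_distrib sum_subtractf
          if_distrib[of "\<lambda>c. c * _"] cong: if_cong)
    then have "w = 0" using ij * by simp
    then have "w $ i = 0" by simp
    then show False using ij(2) by (simp add: w_def axis_def)
  qed
  have "vec.independent (rows M)"
  proof
    assume "vec.dependent (rows M)"
    then obtain u where u: "\<exists>v\<in>rows M. u v \<noteq> 0" "(\<Sum>v\<in>rows M. u v *s v) = 0"
      unfolding rows by (subst (asm) vec.dependent_finite) auto
    define w where "w = (\<chi> i. u (row i M))"
    have "w v* M = (\<Sum>v\<in>rows M. u v *s v)"
      unfolding rows using inj by (simp add: sum.reindex vector_mult_eq_sum_rows w_def)
    then have "w = 0" using u(2) * by simp
    then show False using u(1) by (auto simp: w_def rows vec_eq_iff)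
  qed
  then have "rank M = card (rows M)"
    unfolding row_rank_def_gen by (rule vec.dim_eq_card_independent)
  then show "rank M = CARD('n)"
    unfolding rows using inj by (simp add: card_image)
qed

lemma vector_mult_hcat_eq_0_iff:
  fixes M :: "'a::comm_ring_1^'p^'n" and N :: "'a^'q^'n"
  shows "w v* hcat M N = 0 \<longleftrightarrow> w v* M = 0 \<and> w v* N = 0"
proof -
  have "(\<forall>j. (w v* hcat M N) $ j = 0) \<longleftrightarrow> (\<forall>c. (w v* M) $ c = 0) \<and> (\<forall>c. (w v* N) $ c = 0)"
    by (simp add: vector_matrix_nth hcat_def split_sum_all)
  then show ?thesis by (simp add: vec_eq_iff)
qed

section \<open>Complexification and left eigenvectors\<close>

lemma complex_matrix_mult: "complex_matrix (M ** N) = complex_matrix M ** complex_matrix N"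
  by (simp add: vec_eq_iff matrix_matrix_mult_def)

definition complex_vector :: "real^'n \<Rightarrow> complex^'n" where
  "complex_vector v = (\<chi> i. complex_of_real (v $ i))"

lemma complex_vector_mult: "complex_vector v v* complex_matrix M = complex_vector (v v* M)"
  by (simp add: complex_vector_def vec_eq_iff vector_matrix_nth)

lemma complex_vector_eq_0_iff [simp]: "complex_vector v = 0 \<longleftrightarrow> v = 0"
  by (simp add: complex_vector_def vec_eq_iff)

lemma vector_mult_mat: "w v* mat z = z *s w" for w :: "'a::comm_ring_1^'n"
  by (simp add: vec_eq_iff vector_matrix_nth mat_def if_distrib[of "\<lambda>c. _ * c"] mult.commute cong: if_cong)

text \<open>The row vector w p(M), evaluated by Horner's scheme on vectors, so that no powers of a
  complex matrix have to be formed.\<close>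

definition poly_act :: "complex^'n^'n \<Rightarrow> complex poly \<Rightarrow> complex^'n \<Rightarrow> complex^'n" where
  "poly_act M p w = fold_coeffs (\<lambda>c y. c *s w + y v* M) p 0"

lemma poly_act_0 [simp]: "poly_act M 0 w = 0"
  by (simp add: poly_act_def)

lemma poly_act_pCons [simp]: "poly_act M (pCons c p) w = c *s w + poly_act M p w v* M"
  by (cases "c = 0 \<and> p = 0") (auto simp: poly_act_def)

lemma poly_act_add: "poly_act M (p + q) w = poly_act M p w + poly_act M q w"
  by (induction p q rule: poly_induct2)
     (auto simp: vector_matrix_left_distrib vector_sadd_rdistrib)

lemma poly_act_smult: "poly_act M (smult a p) w = a *s poly_act M p w"
  by (induction p) (auto simp: vector_add_ldistrib scalar_vector_matrix_assoc vector_smult_assoc)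

lemma poly_act_linear_factor:
  "poly_act M ([:- a, 1:] * q) w = poly_act M q w v* M - a *s poly_act M q w"
proof -
  have "[:- a, 1:] * q = smult (- a) q + pCons 0 q" by simp
  then show ?thesis
    by (simp only: poly_act_add poly_act_smult poly_act_pCons) (simp add: vec_eq_iff)
qed

lemma poly_act_complex_vector:
  "poly_act (complex_matrix A) (map_poly complex_of_real p) (complex_vector v) = complex_vector (v v* poly_matrix p A)"
proof (induction p)
  case 0
  then show ?case by (simp add: poly_matrix_def)
next
  case (pCons c p)
  have "complex_vector (v v* poly_matrix (pCons c p) A) = complex_of_real c *s complex_vector v + complex_vector ((v v* poly_matrix p A) v* A)"
    by (simp add: poly_matrix_pCons vector_matrix_mul_assoc vector_matrix_mult_add_rdistrib vector_scaleR_matrix_ac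
        complex_vector_def vec_eq_iff)
  then show ?case
    using pCons by (simp add: map_poly_pCons complex_vector_mult)
qed

text \<open>The linear factors of P are applied to w in turn. Since P(M) sends w to 0, some factor M
  - a kills a nonzero vector, which is an eigenvector; being a polynomial in M applied to w, it lies
  in the invariant subspace \<open>N\<close>.\<close>

lemma left_eigenvector_exists:
  fixes M :: "complex^'n^'n"
  assumes "P \<noteq> 0" "poly_act M P w = 0" "w \<noteq> 0" "w \<in> N"
    and add: "\<And>x y. x \<in> N \<Longrightarrow> y \<in> N \<Longrightarrow> x + y \<in> N" and zero: "0 \<in> N" and scale: "\<And>c x. x \<in> N \<Longrightarrow> c *s x \<in> N"
    and invariant: "\<And>x. x \<in> N \<Longrightarrow> x v* M \<in> N"
  obtains z u where "u \<noteq> 0" "u \<in> N" "u v* M = z *s u"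
  using assms(1,2)
proof (induction "degree P" arbitrary: P thesis rule: less_induct)
  case less
  have act: "poly_act M q w \<in> N" for q
    using \<open>w \<in> N\<close> by (induction q) (auto intro: add zero scale invariant)
  show thesis
  proof (cases "degree P = 0")
    case True
    then obtain c where "P = [:c:]" by (rule degree_eq_zeroE)
    with less assms(3) show ?thesis by simp
  next
    case False
    then obtain a where "poly P a = 0"
      using fundamental_theorem_of_algebra[of P] constant_degree[of P] by auto
    then obtain Q where Q: "P = [:- a, 1:] * Q"
      by (auto simp: poly_eq_0_iff_dvd)
    with less.prems have "Q \<noteq> 0" by auto
    then have deg: "degree Q < degree P"
      unfolding Q by (subst degree_mult_eq) auto
    have eig: "poly_act M Q w v* M = a *s poly_act M Q w"
      using less.prems(3) by (simp only: Q poly_act_linear_factor right_minus_eq)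
    show ?thesis
    proof (cases "poly_act M Q w = 0")
      case True
      then show ?thesis using less.hyps[OF deg _ \<open>Q \<noteq> 0\<close>] less.prems(1) by blast
    next
      case False
      then show ?thesis using eig act less.prems(1) by blast
    qed
  qed
qed

text \<open>The left annihilators of all A^l B form an A-invariant space, so a nonzero real one
  produces a complex left eigenvector killed by B. Conversely such an eigenvector w satisfies w A^l
  B = z^l w B = 0, and its real and imaginary parts are real annihilators.\<close>

lemma kalman_condition_iff_hautus:
  fixes A :: "real^'n^'n" and B :: "real^'m^'n"
  shows "(\<forall>z\<in>spectrum A. rank (hcat (mat z - complex_matrix A) (complex_matrix B)) = CARD('n)) \<longleftrightarrow> kalman_condition A B"
proof -
  have rank: "rank (hcat (mat z - complex_matrix A) (complex_matrix B)) = CARD('n) \<longleftrightarrow>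
      (\<forall>w. w v* complex_matrix A = z *s w \<and> w v* complex_matrix B = 0 \<longrightarrow> w = 0)" for z
    unfolding rank_eq_rows_iff vector_mult_hcat_eq_0_iff
    by (auto simp: vector_matrix_mult_diff_rdistrib vector_mult_mat)
  show ?thesis
    unfolding rank
  proof
    assume H: "\<forall>z\<in>spectrum A. \<forall>w. w v* complex_matrix A = z *s w \<and> w v* complex_matrix B = 0 \<longrightarrow> w = 0"
    show "kalman_condition A B"
      unfolding kalman_condition_def
    proof (intro allI impI, rule ccontr)
      fix v assume v: "\<forall>l. v v* (matpow A l ** B) = 0" "v \<noteq> 0"
      obtain p where p: "p \<noteq> 0" "poly_matrix p A = 0"
        using annihilating_poly_exists by blast
      define N where "N = {w. \<forall>l. w v* complex_matrix (matpow A l ** B) = 0}"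
      obtain z u where u: "u \<noteq> 0" "u \<in> N" "u v* complex_matrix A = z *s u"
      proof (rule left_eigenvector_exists[where P="map_poly complex_of_real p" and w="complex_vector v" and N=N and M="complex_matrix A"])
        show "map_poly complex_of_real p \<noteq> 0" using p(1) by (simp add: map_poly_eq_0_iff)
        show "poly_act (complex_matrix A) (map_poly complex_of_real p) (complex_vector v) = 0"
          using p(2) by (simp add: poly_act_complex_vector)
        show "complex_vector v \<in> N" using v by (simp add: N_def complex_vector_mult)
        show "x v* complex_matrix A \<in> N" if "x \<in> N" for x
        proof -
          have "(x v* complex_matrix A) v* complex_matrix (matpow A l ** B) = x v* complex_matrix (matpow A (Suc l) ** B)" for l
            by (simp add: vector_matrix_mul_assoc complex_matrix_mult matrix_mul_assoc)
          with that show ?thesis unfolding N_def by (simp del: matpow.simps)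
        qed
      qed (use v in \<open>auto simp: N_def vector_matrix_left_distrib scalar_vector_matrix_assoc\<close>)
      \<comment> \<open>The rank hypothesis \<open>H\<close> is available on the spectrum only; an
        inverse of z - A would recover u from u (z - A) = 0.\<close>
      have "z \<in> spectrum A"
      proof -
        have "\<not> invertible (mat z - complex_matrix A)"
        proof
          assume "invertible (mat z - complex_matrix A)"
          then obtain C where "(mat z - complex_matrix A) ** C = mat 1" by (auto simp: invertible_def)
          then have "u = (u v* (mat z - complex_matrix A)) v* C"
            by (simp add: vector_matrix_mul_assoc)
          also have "u v* (mat z - complex_matrix A) = 0"
            using u(3) by (simp add: vector_matrix_mult_diff_rdistrib vector_mult_mat)
          finally show False using u(1) by simp
        qed
        then show ?thesis by (simp add: spectrum_def)
      qed
      moreover have "u v* complex_matrix B = 0"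
      proof -
        have "u v* complex_matrix (matpow A 0 ** B) = 0" using u(2) unfolding N_def by blast
        then show ?thesis by simp
      qed
      ultimately show False using H u by blast
    qed
  next
    assume K: "kalman_condition A B"
    show "\<forall>z\<in>spectrum A. \<forall>w. w v* complex_matrix A = z *s w \<and> w v* complex_matrix B = 0 \<longrightarrow> w = 0"
    proof (intro ballI allI impI)
      fix z w assume w: "w v* complex_matrix A = z *s w \<and> w v* complex_matrix B = 0"
      have "w v* complex_matrix (matpow A l ** B) = 0" for l
      proof (induction l)
        case 0
        then show ?case using w by simp
      next
        case (Suc l)
        have "w v* complex_matrix (matpow A (Suc l) ** B) = (w v* complex_matrix A) v* complex_matrix (matpow A l ** B)"
          by (simp add: vector_matrix_mul_assoc complex_matrix_mult matrix_mul_assoc)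
        also have "\<dots> = z *s (w v* complex_matrix (matpow A l ** B))"
          using w by (simp add: scalar_vector_matrix_assoc)
        finally show ?case using Suc by simp
      qed
      then have *: "(\<Sum>i\<in>UNIV. w $ i * complex_of_real ((matpow A l ** B) $ i $ j)) = 0" for l j
        by (metis (no_types, lifting) nth_map_matrix sum.cong vector_matrix_nth zero_index)
      have "(\<chi> i. Re (w $ i)) v* (matpow A l ** B) = 0" for l
        using arg_cong[OF *, of Re l] by (simp add: vec_eq_iff vector_matrix_nth)
      then have re: "(\<chi> i. Re (w $ i)) = 0" using K by (simp add: kalman_condition_def)
      have "(\<chi> i. Im (w $ i)) v* (matpow A l ** B) = 0" for l
        using arg_cong[OF *, of Im l] by (simp add: vec_eq_iff vector_matrix_nth)
      then have "(\<chi> i. Im (w $ i)) = 0" using K by (simp add: kalman_condition_def)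
      with re show "w = 0" by (simp add: vec_eq_iff complex_eq_iff)
    qed
  qed
qed

section \<open>The Gramian\<close>

text \<open>Once the lower coefficients vanish, dividing by x^l and letting x tend to 0 from the
  right isolates \<open>c l\<close>. The hypothesis is one-sided because it is used with x =
  \<tau>^\<alpha>.\<close>

lemma powser_eq_0_imp_coeffs_eq_0:
  fixes c :: "nat \<Rightarrow> real"
  assumes r: "r > 0" and zero: "\<And>x. 0 < x \<Longrightarrow> x < r \<Longrightarrow> (\<lambda>l. c l * x ^ l) sums 0"
  shows "c l = 0"
proof (induction l rule: less_induct)
  case (less l)
  define f where "f = (\<lambda>x. \<Sum>j. c (j + l) * x ^ j)"
  have zero': "(\<lambda>j. c (j + l) * x ^ j) sums 0" if x: "0 < x" "x < r" for x
  proof -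
    have "(\<lambda>j. c (j + l) * x ^ (j + l)) sums 0"
      using zero[OF x] sums_iff_shift[of "\<lambda>j. c j * x ^ j" l 0] less by simp
    then have "(\<lambda>j. inverse (x ^ l) * (c (j + l) * x ^ (j + l))) sums (inverse (x ^ l) * 0)"
      by (rule sums_mult)
    then show ?thesis using x by (simp add: power_add field_simps)
  qed
  have "(f \<longlongrightarrow> c (0 + l)) (at 0)"
  proof (rule powser_limit_0[OF r, where a="\<lambda>j. c (j + l)"])
    \<comment> \<open>The limit lemma asks for convergence at both signs of x; it is inherited from
      a positive y with |x| < y < r.\<close>
    fix x :: real assume "norm x < r"
    then obtain y where y: "norm x < y" "y < r" using dense by blast
    then have "y > 0" using norm_ge_zero[of x] by linarith
    then have "summable (\<lambda>j. c (j + l) * y ^ j)" using zero'[of y] y by (simp add: sums_iff)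
    then have "summable (\<lambda>j. c (j + l) * x ^ j)"
      using y \<open>y > 0\<close> by (elim powser_inside) simp
    then show "(\<lambda>j. c (j + l) * x ^ j) sums f x" unfolding f_def by (rule summable_sums)
  qed
  then have "(f \<longlongrightarrow> c l) (at_right 0)"
    by (simp add: filterlim_at_split)
  moreover have "(f \<longlongrightarrow> 0) (at_right 0)"
  proof (rule tendsto_eventually)
    show "\<forall>\<^sub>F x in at_right 0. f x = 0"
      using eventually_at_right_less[of 0] eventually_at_right_real[OF r]
      by eventually_elim (use zero' in \<open>auto simp: f_def sums_iff\<close>)
  qed
  ultimately show "c l = 0"
    by (intro tendsto_unique[of "at_right 0" f]) auto
qed

text \<open>The norm of the matrix type is the Euclidean norm of the entries, not the operator norm;
  bounding it by the sum over all entries costs the factor n^2.\<close>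

lemma norm_matpow_le:
  fixes A :: "real^'n^'n"
  obtains C M where "C \<ge> 0" "M > 0" "\<And>l. norm (matpow A l) \<le> C * M ^ l"
proof -
  obtain M where M: "M > 0" "\<And>l v. norm (matpow A l *v v) \<le> M ^ l * norm v"
    using matpow_bound[of A] by blast
  have "norm (matpow A l) \<le> (real CARD('n) * real CARD('n)) * M ^ l" for l
  proof -
    have entry: "norm (matpow A l $ i $ j) \<le> M ^ l" for i j
    proof -
      have "matpow A l $ i $ j = (matpow A l *v axis j 1) $ i"
        by (simp add: matrix_vector_mult_basis column_def)
      also have "norm \<dots> \<le> norm (matpow A l *v axis j 1)"
        by (rule Finite_Cartesian_Product.norm_nth_le)
      also have "\<dots> \<le> M ^ l"
        using M(2)[of l "axis j 1"] by simp
      finally show ?thesis by simp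
    qed
    have "norm (matpow A l) \<le> (\<Sum>i\<in>UNIV. norm (matpow A l $ i))"
      unfolding norm_vec_def by (rule L2_set_le_sum) auto
    also have "\<dots> \<le> (\<Sum>i\<in>(UNIV::'n set). real CARD('n) * M ^ l)"
    proof (rule sum_mono)
      fix i
      have "norm (matpow A l $ i) \<le> (\<Sum>j\<in>UNIV. norm (matpow A l $ i $ j))"
        unfolding norm_vec_def[of "matpow A l $ i"] by (rule L2_set_le_sum) auto
      also have "\<dots> \<le> (\<Sum>j\<in>(UNIV::'n set). M ^ l)"
        by (intro sum_mono entry)
      finally show "norm (matpow A l $ i) \<le> real CARD('n) * M ^ l" by simp
    qed
    finally show ?thesis by simp
  qed
  then show ?thesis using M(1) by (intro that[of "real CARD('n) * real CARD('n)" M]) auto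
qed

section \<open>The function \<open>Phi\<close> as a power series in \<tau>^\<alpha>, and the Gramian
  criterion\<close>

context
  fixes \<alpha> :: real and A :: "real^'n^'n"
  assumes \<alpha>: "\<alpha> > 0"
begin

lemma Phi_uniform_limit:
  assumes "T \<ge> 0"
  shows "uniform_limit {0..T} (\<lambda>n \<tau>. \<Sum>l<n. ((\<tau> powr \<alpha>) ^ l / Gamma (\<alpha> * (real l + 1))) *\<^sub>R matpow A l) (Phi \<alpha> A) sequentially"
proof -
  obtain C M where M: "C \<ge> 0" "M > 0" "\<And>l. norm (matpow A l) \<le> C * M ^ l"
    using norm_matpow_le[of A] by blast
  have pos: "Gamma (\<alpha> * (real l + 1)) > 0" for l
    using \<alpha> by (intro Gamma_real_pos mult_pos_pos) auto
  have "uniform_limit {0..T} (\<lambda>n \<tau>. \<Sum>l<n. ((\<tau> powr \<alpha>) ^ l / Gamma (\<alpha> * (real l + 1))) *\<^sub>R matpow A l)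
      (\<lambda>\<tau>. \<Sum>l. ((\<tau> powr \<alpha>) ^ l / Gamma (\<alpha> * (real l + 1))) *\<^sub>R matpow A l) sequentially"
  proof (rule Weierstrass_m_test)
    show "summable (\<lambda>l. (T powr \<alpha> * M) ^ l / Gamma (\<alpha> * real l + \<alpha>) * C)"
      using \<alpha> by (intro summable_mult2 summable_Gamma_power) auto
    fix l \<tau> assume \<tau>: "\<tau> \<in> {0..T}"
    have "norm (((\<tau> powr \<alpha>) ^ l / Gamma (\<alpha> * (real l + 1))) *\<^sub>R matpow A l) = (\<tau> powr \<alpha>) ^ l / Gamma (\<alpha> * (real l + 1)) * norm (matpow A l)"
      using pos[of l] by simp
    also have "\<dots> \<le> (T powr \<alpha>) ^ l / Gamma (\<alpha> * (real l + 1)) * (C * M ^ l)"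
      using \<tau> \<alpha> pos[of l] M(3)[of l]
      by (intro mult_mono divide_right_mono power_mono powr_mono2) auto
    also have "\<dots> = (T powr \<alpha> * M) ^ l / Gamma (\<alpha> * real l + \<alpha>) * C"
      by (simp add: distrib_left power_mult_distrib)
    finally show "norm (((\<tau> powr \<alpha>) ^ l / Gamma (\<alpha> * (real l + 1))) *\<^sub>R matpow A l) \<le> (T powr \<alpha> * M) ^ l / Gamma (\<alpha> * real l + \<alpha>) * C" .
  qed
  then show ?thesis by (simp add: Phi_def[abs_def])
qed

lemma Phi_sums:
  assumes "\<tau> \<ge> 0"
  shows "(\<lambda>l. ((\<tau> powr \<alpha>) ^ l / Gamma (\<alpha> * (real l + 1))) *\<^sub>R matpow A l) sums Phi \<alpha> A \<tau>"
  unfolding sums_def by (rule tendsto_uniform_limitI[OF Phi_uniform_limit[OF assms]]) (use assms in auto)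

lemma continuous_on_Phi: "continuous_on {0..T} (Phi \<alpha> A)"
proof (cases "T \<ge> 0")
  case True
  have "continuous_on {0..T} (\<lambda>\<tau>. \<Sum>l<n. ((\<tau> powr \<alpha>) ^ l / Gamma (\<alpha> * (real l + 1))) *\<^sub>R matpow A l)" for n
    using \<alpha> by (intro continuous_on_sum continuous_on_scaleR continuous_on_divide continuous_on_power continuous_on_powr'
        continuous_on_id continuous_on_const) auto
  then show ?thesis
    by (intro uniform_limit_theorem[OF _ Phi_uniform_limit[OF True]] always_eventually) auto
qed auto

lemma vector_Phi_sums:
  fixes B :: "real^'m^'n"
  assumes "\<tau> \<ge> 0"
  shows "(\<lambda>l. ((\<tau> powr \<alpha>) ^ l / Gamma (\<alpha> * (real l + 1))) *\<^sub>R (v v* (matpow A l ** B))) sums (v v* (Phi \<alpha> A \<tau> ** B))"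
proof -
  have "linear (\<lambda>X :: real^'n^'n. v v* (X ** B))"
    by (simp add: linear_iff linear_add[OF linear_matrix_mult_left] linear_cmul[OF linear_matrix_mult_left]
        vector_matrix_mult_add_rdistrib vector_scaleR_matrix_ac)
  then have bl: "bounded_linear (\<lambda>X :: real^'n^'n. v v* (X ** B))"
    by (simp add: linear_conv_bounded_linear)
  show ?thesis
    using bounded_linear.sums[OF bl Phi_sums[OF assms]] by (simp add: linear_cmul[OF \<open>linear _\<close>])
qed

text \<open>In the variable x = \<tau>^\<alpha> each entry of v Phi B is an ordinary power series
  whose coefficients are the entries of v A^l B divided by positive Gamma values; vanishing on (0,
  T^\<alpha>) kills them all.\<close>

lemma vector_Phi_eq_0_iff:
  fixes B :: "real^'m^'n"
  assumes T: "T > 0"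
  shows "(\<forall>\<tau>\<in>{0..T}. v v* (Phi \<alpha> A \<tau> ** B) = 0) \<longleftrightarrow> (\<forall>l. v v* (matpow A l ** B) = 0)"
proof
  assume "\<forall>l. v v* (matpow A l ** B) = 0"
  then show "\<forall>\<tau>\<in>{0..T}. v v* (Phi \<alpha> A \<tau> ** B) = 0"
    using vector_Phi_sums[of _ v B] sums_unique2[OF sums_zero] by force
next
  assume zero: "\<forall>\<tau>\<in>{0..T}. v v* (Phi \<alpha> A \<tau> ** B) = 0"
  show "\<forall>l. v v* (matpow A l ** B) = 0"
  proof
    fix l
    have "(v v* (matpow A l ** B)) $ j = 0" for j
    proof -
      define c where "c = (\<lambda>l. (v v* (matpow A l ** B)) $ j / Gamma (\<alpha> * (real l + 1)))"
      have "c l = 0"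
      proof (rule powser_eq_0_imp_coeffs_eq_0)
        show "T powr \<alpha> > 0" using T by simp
        fix x :: real assume x: "0 < x" "x < T powr \<alpha>"
        define \<tau> where "\<tau> = x powr (1 / \<alpha>)"
        have "\<tau> \<le> (T powr \<alpha>) powr (1 / \<alpha>)"
          unfolding \<tau>_def using x \<alpha> by (intro powr_mono2) auto
        then have \<tau>: "\<tau> \<in> {0..T}" "\<tau> powr \<alpha> = x"
          using x \<alpha> T by (auto simp: \<tau>_def powr_powr)
        from bounded_linear.sums[OF bounded_linear_vec_nth[of j] vector_Phi_sums[of \<tau> v B]] zero \<tau>
        show "(\<lambda>l. c l * x ^ l) sums 0"
          by (simp add: c_def mult.commute)
      qed
      moreover have "Gamma (\<alpha> * (real l + 1)) > 0"
        using \<alpha> by (intro Gamma_real_pos mult_pos_pos) auto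
      ultimately show ?thesis by (auto simp: c_def)
    qed
    then show "v v* (matpow A l ** B) = 0" by (simp add: vec_eq_iff)
  qed
qed

text \<open>The quadratic form of the Gramian is the integral of |v Phi B|^2, a continuous
  nonnegative function, and so vanishes only if v Phi B does on [0,T]. By the power series argument
  this condition on v is the same for every T > 0.\<close>

lemma kalman_condition_iff_gramian:
  fixes B :: "real^'m^'n"
  shows "(\<forall>T>0. pos_definite (integral {0..T} (\<lambda>\<tau>. Phi \<alpha> A \<tau> ** B ** transpose B ** transpose (Phi \<alpha> A \<tau>)))) \<longleftrightarrow>
    kalman_condition A B"
proof -
  define F where "F = (\<lambda>\<tau>. Phi \<alpha> A \<tau> ** B ** transpose B ** transpose (Phi \<alpha> A \<tau>))"
  have F_eq: "F \<tau> = (Phi \<alpha> A \<tau> ** B) ** transpose (Phi \<alpha> A \<tau> ** B)" for \<tau>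
    by (simp add: F_def matrix_transpose_mul matrix_mul_assoc)
  have contB: "continuous_on {0..T} (\<lambda>\<tau>. Phi \<alpha> A \<tau> ** B)" for T
  proof -
    have "bounded_linear (\<lambda>X :: real^'n^'n. X ** B)"
      using linear_matrix_mult_left by (simp add: linear_conv_bounded_linear)
    then show ?thesis
      by (rule bounded_linear.continuous_on) (rule continuous_on_Phi)
  qed
  have "continuous_on {0..T} F" for T
  proof -
    have "F = (\<lambda>\<tau>. \<chi> i j. \<Sum>c\<in>UNIV. (Phi \<alpha> A \<tau> ** B) $ i $ c * (Phi \<alpha> A \<tau> ** B) $ j $ c)"
      unfolding F_eq[abs_def] matrix_matrix_mult_def[of _ "transpose _"] by (simp add: transpose_def)
    moreover have "continuous_on {0..T} (\<lambda>\<tau>. (Phi \<alpha> A \<tau> ** B) $ i $ c)" for i c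
      using contB by (intro continuous_on_component)
    ultimately show ?thesis
      by (auto intro!: continuous_on_vec_lambda continuous_on_sum continuous_on_mult)
  qed
  then have int: "F integrable_on {0..T}" for T
    by (rule integrable_continuous_real)
  have sym: "transpose (integral {0..T} F) = integral {0..T} F" for T
  proof -
    have "linear (transpose :: real^'n^'n \<Rightarrow> real^'n^'n)"
      by (simp add: linear_iff transpose_def vec_eq_iff)
    then have "bounded_linear (transpose :: real^'n^'n \<Rightarrow> real^'n^'n)"
      by (simp add: linear_conv_bounded_linear)
    moreover have "transpose (F \<tau>) = F \<tau>" for \<tau>
      unfolding F_eq by (simp only: matrix_transpose_mul transpose_transpose)
    ultimately show ?thesis
      using integral_linear[OF int, of transpose T] by (simp add: o_def)
  qed
  have quad: "v \<bullet> (integral {0..T} F *v v) = integral {0..T} (\<lambda>\<tau>. (v v* (Phi \<alpha> A \<tau> ** B)) \<bullet> (v v* (Phi \<alpha> A \<tau> ** B)))" for v T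
  proof -
    have "linear (\<lambda>X :: real^'n^'n. v \<bullet> (X *v v))"
      by (simp add: linear_iff matrix_vector_mult_add_rdistrib inner_add_right scaleR_matrix_vector_assoc[symmetric])
    then have "bounded_linear (\<lambda>X :: real^'n^'n. v \<bullet> (X *v v))"
      by (simp add: linear_conv_bounded_linear)
    moreover have "v \<bullet> (F \<tau> *v v) = (v v* (Phi \<alpha> A \<tau> ** B)) \<bullet> (v v* (Phi \<alpha> A \<tau> ** B))" for \<tau>
      unfolding F_eq by (simp add: matrix_vector_mul_assoc[symmetric] dot_lmul_matrix)
    ultimately show ?thesis
      using integral_linear[OF int, of "\<lambda>X. v \<bullet> (X *v v)" T] by (simp add: o_def)
  qed
  have contq: "continuous_on {0..T} (\<lambda>\<tau>. (v v* (Phi \<alpha> A \<tau> ** B)) \<bullet> (v v* (Phi \<alpha> A \<tau> ** B)))" for v T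
  proof -
    have "bounded_linear (\<lambda>X :: real^'m^'n. v v* X)"
      by (simp add: linear_conv_bounded_linear[symmetric] linear_iff vector_matrix_mult_add_rdistrib vector_scaleR_matrix_ac)
    then have "continuous_on {0..T} (\<lambda>\<tau>. v v* (Phi \<alpha> A \<tau> ** B))"
      by (rule bounded_linear.continuous_on) (rule contB)
    then show ?thesis
      by (intro continuous_on_inner)
  qed
  have zero_iff: "v \<bullet> (integral {0..T} F *v v) = 0 \<longleftrightarrow> (\<forall>l. v v* (matpow A l ** B) = 0)" if T: "T > 0" for v T
  proof -
    have "v \<bullet> (integral {0..T} F *v v) = 0 \<longleftrightarrow> (\<forall>\<tau>\<in>{0..T}. v v* (Phi \<alpha> A \<tau> ** B) = 0)"
      unfolding quad using T integral_eq_0_iff[OF contq T, of v] by simp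
    then show ?thesis using vector_Phi_eq_0_iff[OF T] by simp
  qed
  have nonneg: "v \<bullet> (integral {0..T} F *v v) \<ge> 0" for v T
    unfolding quad using contq
    by (intro Henstock_Kurzweil_Integration.integral_nonneg integrable_continuous_real) auto
  have "pos_definite (integral {0..T} F) \<longleftrightarrow> kalman_condition A B" if T: "T > 0" for T
    unfolding pos_definite_def kalman_condition_def
    using sym[of T] zero_iff[OF T] nonneg[of _ T] by (metis less_le)
  \<comment> \<open>Each single T > 0 already gives the equivalence; \<open>zero_less_one\<close>
    supplies one such T for the direction from left to right.\<close>
  then have "(\<forall>T>0. pos_definite (integral {0..T} F)) \<longleftrightarrow> kalman_condition A B"
    using zero_less_one by blast
  then show ?thesis by (simp add: F_def)
qed

end

theorem theorem4p9:
  fixes A :: "real^'n^'n" and B :: "real^'m^'n"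
    and \<mu> k :: nat and \<alpha> t :: real
  assumes "\<mu> = degree (min_poly A)"
    and "0 < \<alpha>" and "0 < k" and "real k - 1 < \<alpha>" and "\<alpha> \<le> real k"
    and "0 < t"
  shows "(caputo_controllable \<alpha> k A B t \<longleftrightarrow>
            block_row_rank (\<lambda>i. matpow A i ** B) \<mu> = CARD('n)) \<and>
         (caputo_controllable \<alpha> k A B t \<longleftrightarrow>
            (\<forall>z\<in>spectrum A.
               rank (hcat (mat z - complex_matrix A) (complex_matrix B)) = CARD('n))) \<and>
         (caputo_controllable \<alpha> k A B t \<longleftrightarrow>
            (\<forall>T>0. pos_definite
               (integral {0..T}
                  (\<lambda>\<tau>. Phi \<alpha> A \<tau> ** B ** transpose B ** transpose (Phi \<alpha> A \<tau>)))))"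
proof -
  have "caputo_controllable \<alpha> k A B t \<longleftrightarrow> kalman_condition A B"
    using kalman_condition_imp_controllable[OF assms(2-6)] controllable_imp_kalman_condition[OF assms(2,3,5,4,6)]
    by blast
  then show ?thesis
    using kalman_condition_iff_block_row_rank[of A B] kalman_condition_iff_hautus[of A B]
      kalman_condition_iff_gramian[OF assms(2), of A B] assms(1)
    by simp
qed

end
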